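(* The solution of the generalized eigenvalue problem $$A_{h_t}\underline{v}=\lambda\,M_{h_t}\underline{v}$$ is given by the eigenvectors $\underline{v}_\ell$, $\ell=0,\ldots,N_t-1$, with components $$v_{\ell,i}=\sin\left(\Big(\frac{\pi}{2}+\ell\pi\Big)\frac{i}{N_t}\right)\quad\text{for } i=1,\ldots,N_t,$$ and with the corresponding eigenvalues $$\lambda_\ell=\frac{3\pi}{2T}\,\frac{\sin^4x_\ell}{x_\ell^4}\,\frac{1}{2+\cos(2x_\ell)}\,\sum_{\mu=0}^\infty\left[\frac{(2\ell+1)^4}{(4\mu N_t+2\ell+1)^3}+\frac{(2\ell+1)^4}{(4\mu N_t+4N_t-1-2\ell)^3}\right],$$ where $$x_\ell=\Big(\frac{\pi}{2}+\ell\pi\Big)\frac{1}{2N_t}.$$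
   Context: Let $T>0$, $N_t\in\mathbb{N}$, $h_t=T/N_t$, $t_k=kh_t$. $V_{h_t}=\mathrm{span}\{\varphi_k\}_{k=1}^{N_t}$ is the space of continuous functions on $[0,T]$ vanishing at $t=0$ that are piecewise linear with respect to the uniform mesh $\{t_k\}_{k=0}^{N_t}$, where $\varphi_k$ are the nodal hat functions, $\varphi_k(t_j)=\delta_{kj}$. Modified Hilbert transformation: for $u\in L^2(0,T)$ with $u(t)=\sum_{k=0}^\infty u_k \sin\big((\frac{\pi}{2}+k\pi)\frac{t}{T}\big)$, $u_k = \frac{2}{T}\int_0^T u(t)\sin\big((\frac{\pi}{2}+k\pi)\frac{t}{T}\big)\,dt$, set $\mathcal{H}_Tu(t)=\sum_{k=0}^\infty u_k\cos\big((\frac{\pi}{2}+k\pi)\frac{t}{T}\big)$. Matrices: $A_{h_t}[j,i]=\langle\partial_t\varphi_i,\mathcal{H}_T\varphi_j\rangle_{L^2(0,T)}$ and $M_{h_t}[j,i]=\langle\varphi_i,\varphi_j\rangle_{L^2(0,T)}$ for $i,j=1,\dots,N_t$. *)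

theory Defs
  imports
    "HOL-Analysis.Set_Integral"
    "HOL-Analysis.Lebesgue_Measure"
    "HOL-Analysis.Derivative"
    "Jordan_Normal_Form.VS_Connect"
begin

section \<open>The space \<open>L\<^sup>2(0,T)\<close> and the modified Hilbert transformation\<close>

text \<open>Elements of \<open>L\<^sup>2(0,T)\<close> are represented by functions on the reals; only their values on
  the open interval matter, and only up to null sets.\<close>

definition L2 :: "real \<Rightarrow> (real \<Rightarrow> real) set" where
  "L2 T = {u. set_borel_measurable lborel {0<..<T} u
              \<and> set_integrable lborel {0<..<T} (\<lambda>t. (u t)\<^sup>2)}"

definition L2_inner :: "real \<Rightarrow> (real \<Rightarrow> real) \<Rightarrow> (real \<Rightarrow> real) \<Rightarrow> real" where
  "L2_inner T u w = set_lebesgue_integral lborel {0<..<T} (\<lambda>t. u t * w t)"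

definition freq :: "real \<Rightarrow> nat \<Rightarrow> real" where
  "freq T k = (pi / 2 + real k * pi) / T"

definition sine_fourier_coeff :: "real \<Rightarrow> (real \<Rightarrow> real) \<Rightarrow> nat \<Rightarrow> real" where
  "sine_fourier_coeff T u k = 2 / T * set_lebesgue_integral lborel {0<..<T} (\<lambda>t. u t * sin (freq T k * t))"

text \<open>The cosine series defining the transform converges in \<open>L\<^sup>2(0,T)\<close>.\<close>

definition is_mod_Hilbert :: "real \<Rightarrow> (real \<Rightarrow> real) \<Rightarrow> (real \<Rightarrow> real) \<Rightarrow> bool" where
  "is_mod_Hilbert T u w \<longleftrightarrow> w \<in> L2 T \<and>
     (\<lambda>n. set_lebesgue_integral lborel {0<..<T}
            (\<lambda>t. (w t - (\<Sum>k<n. sine_fourier_coeff T u k * cos (freq T k * t)))\<^sup>2)) \<longlonglongrightarrow> 0"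

text \<open>The \<open>L\<^sup>2\<close> limit is an equivalence class modulo null sets, so \<open>SOME\<close> merely picks a
  representative; \<open>L2_inner\<close> does not depend on which one.\<close>

definition mod_Hilbert :: "real \<Rightarrow> (real \<Rightarrow> real) \<Rightarrow> real \<Rightarrow> real" where
  "mod_Hilbert T u = (SOME w. is_mod_Hilbert T u w)"

section \<open>Piecewise linear finite elements on a uniform mesh\<close>

definition mesh_pt :: "real \<Rightarrow> nat \<Rightarrow> nat \<Rightarrow> real" where
  "mesh_pt T N k = real k * (T / real N)"

definition pl_space :: "real \<Rightarrow> nat \<Rightarrow> (real \<Rightarrow> real) set" where
  "pl_space T N = {u. continuous_on {0..T} u \<and> u 0 = 0 \<and>
     (\<forall>k<N. \<exists>a b. \<forall>t\<in>{mesh_pt T N k..mesh_pt T N (Suc k)}. u t = a + b * t)}"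

text \<open>The last hat function exceeds \<open>[0,T]\<close> on the right; on \<open>[0,T]\<close> it is the half hat
  at the end point.  The lemmas below show that these are the nodal basis functions
  of \<open>pl_space\<close>.\<close>

definition hat :: "real \<Rightarrow> nat \<Rightarrow> nat \<Rightarrow> real \<Rightarrow> real" where
  "hat T N k t = max 0 (1 - \<bar>t - mesh_pt T N k\<bar> / (T / real N))"

lemma hat_scaled:
  assumes "T > 0" "N \<ge> 1"
  shows "hat T N k t = max 0 (1 - \<bar>t / (T / real N) - real k\<bar>)"
proof -
  define h where "h = T / real N"
  have h: "h > 0" using assms by (simp add: h_def)
  have "\<bar>t - real k * h\<bar> / h = \<bar>(t - real k * h) / h\<bar>" using h by simp
  also have "(t - real k * h) / h = t / h - real k" using h by (simp add: field_simps)
  finally show ?thesis unfolding hat_def mesh_pt_def h_def[symmetric] by simp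
qed

lemma hat_mesh_pt:
  assumes "T > 0" "N \<ge> 1"
  shows "hat T N k (mesh_pt T N j) = (if j = k then 1 else 0)"
proof -
  have "mesh_pt T N j / (T / real N) = real j"
    using assms by (simp add: mesh_pt_def)
  then show ?thesis using assms by (auto simp: hat_scaled max_def)
qed

lemma hat_on_cell:
  assumes "T > 0" "N \<ge> 1" "t \<in> {mesh_pt T N m..mesh_pt T N (Suc m)}"
  shows "hat T N k t =
    (if k = m then real (Suc m) - t / (T / real N)
     else if k = Suc m then t / (T / real N) - real m else 0)"
proof -
  define h where "h = T / real N"
  have h: "h > 0" using assms by (simp add: h_def)
  have "real m * h \<le> t" "t \<le> real (Suc m) * h"
    using assms(3) by (auto simp: mesh_pt_def h_def)
  then have *: "real m \<le> t / h" "t / h \<le> real m + 1"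
    using h by (simp_all add: pos_le_divide_eq pos_divide_le_eq add.commute)
  show ?thesis
  proof (cases "k = m \<or> k = Suc m")
    case True
    then show ?thesis unfolding hat_scaled[OF assms(1,2)] h_def[symmetric] using * by auto
  next
    case False
    then consider "k < m" | "k > Suc m" by linarith
    then have "\<bar>t / h - real k\<bar> \<ge> 1"
    proof cases
      case 1
      then have "real k + 1 \<le> real m" by linarith
      with * show ?thesis by linarith
    next
      case 2
      then have "real m + 2 \<le> real k" by linarith
      with * show ?thesis by linarith
    qed
    with False show ?thesis unfolding hat_scaled[OF assms(1,2)] h_def[symmetric] by auto
  qed
qed

lemma hat_in_pl_space:
  assumes "T > 0" "N \<ge> 1" "k \<in> {1..N}"
  shows "hat T N k \<in> pl_space T N"
proof -
  have "continuous_on {0..T} (hat T N k)"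
    unfolding hat_def using assms by (intro continuous_intros) auto
  moreover have "hat T N k 0 = 0"
    using hat_mesh_pt[OF assms(1,2), of k 0] assms(3) by (simp add: mesh_pt_def)
  moreover have "\<exists>a b. \<forall>t\<in>{mesh_pt T N m..mesh_pt T N (Suc m)}. hat T N k t = a + b * t" for m
  proof -
    define a where "a = (if k = m then real (Suc m) else if k = Suc m then - real m else 0)"
    define b where "b = (if k = m then - (real N / T) else if k = Suc m then real N / T else 0)"
    have "\<forall>t\<in>{mesh_pt T N m..mesh_pt T N (Suc m)}. hat T N k t = a + b * t"
      using hat_on_cell[OF assms(1,2)] by (auto simp: a_def b_def)
    then show ?thesis by blast
  qed
  ultimately show ?thesis by (simp add: pl_space_def)
qed

lemma pl_space_expansion:
  assumes "T > 0" "N \<ge> 1" "u \<in> pl_space T N" "t \<in> {0..T}"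
  shows "u t = (\<Sum>k = 1..N. u (mesh_pt T N k) * hat T N k t)"
proof -
  define h where "h = T / real N"
  have h: "h > 0" and hN: "h * real N = T" using assms by (simp_all add: h_def)
  have ex: "\<exists>m<N. t \<in> {mesh_pt T N m..mesh_pt T N (Suc m)}"
  proof (cases "t = T")
    case True
    then have "t \<in> {mesh_pt T N (N - 1)..mesh_pt T N (Suc (N - 1))}"
      using assms h hN by (auto simp: mesh_pt_def of_nat_diff field_simps)
    moreover have "N - 1 < N" using assms by simp
    ultimately show ?thesis by blast
  next
    case False
    define m where "m = nat \<lfloor>t / h\<rfloor>"
    have t0: "t / h \<ge> 0" and tN: "t / h < real N"
      using assms h hN False by (auto simp: pos_divide_less_eq mult.commute)
    have m: "real m \<le> t / h" "t / h < real m + 1" using t0 by (auto simp: m_def)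
    then have "m < N" using tN by linarith
    moreover have "t \<in> {mesh_pt T N m..mesh_pt T N (Suc m)}"
      using m h by (auto simp: mesh_pt_def h_def[symmetric] pos_le_divide_eq pos_divide_less_eq
          add.commute)
    ultimately show ?thesis by blast
  qed
  then obtain m where m: "m < N" "t \<in> {mesh_pt T N m..mesh_pt T N (Suc m)}" by blast
  obtain a b where ab: "\<And>s. s \<in> {mesh_pt T N m..mesh_pt T N (Suc m)} \<Longrightarrow> u s = a + b * s"
    using assms(3) m(1) unfolding pl_space_def by blast
  have le: "mesh_pt T N m \<le> mesh_pt T N (Suc m)"
    using h by (simp add: mesh_pt_def h_def[symmetric] mult_right_mono)
  have u0: "u (mesh_pt T N 0) = 0" using assms(3) by (simp add: pl_space_def mesh_pt_def)
  have "(\<Sum>k = 1..N. u (mesh_pt T N k) * hat T N k t)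
      = (\<Sum>k\<in>{0..N}. u (mesh_pt T N k) * hat T N k t)"
    by (rule sum.mono_neutral_left) (use u0 in \<open>auto simp: not_less_eq_eq\<close>)
  also have "\<dots> = (\<Sum>k\<in>{m, Suc m}. u (mesh_pt T N k) * hat T N k t)"
    by (rule sum.mono_neutral_right) (use m in \<open>auto simp: hat_on_cell[OF assms(1,2) m(2)]\<close>)
  also have "\<dots> = (a + b * (real m * h)) * (real (Suc m) - t / h)
                + (a + b * (real (Suc m) * h)) * (t / h - real m)"
    using ab[of "mesh_pt T N m"] ab[of "mesh_pt T N (Suc m)"] le
    by (simp add: hat_on_cell[OF assms(1,2) m(2)] h_def[symmetric])
       (simp add: mesh_pt_def h_def[symmetric])
  also have "\<dots> = a + b * t" using h by (simp add: field_simps)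
  also have "\<dots> = u t" using ab[OF m(2)] by simp
  finally show ?thesis by simp
qed

section \<open>The generalized eigenvalue problem\<close>

text \<open>Matrix and vector indices start at 0, so entry \<open>(j, i)\<close> belongs to the pair of hat functions
  with numbers \<open>j + 1\<close> and \<open>i + 1\<close>.  The pointwise derivative \<open>deriv\<close> agrees with the weak one
  away from the finitely many mesh points.\<close>

definition A_mat :: "real \<Rightarrow> nat \<Rightarrow> real mat" where
  "A_mat T N = mat N N (\<lambda>(j, i).
     L2_inner T (deriv (hat T N (Suc i))) (mod_Hilbert T (hat T N (Suc j))))"

definition M_mat :: "real \<Rightarrow> nat \<Rightarrow> real mat" where
  "M_mat T N = mat N N (\<lambda>(j, i). L2_inner T (hat T N (Suc i)) (hat T N (Suc j)))"

definition gen_eigenpair :: "real mat \<Rightarrow> real mat \<Rightarrow> real \<Rightarrow> real vec \<Rightarrow> bool" where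
  "gen_eigenpair A M c v \<longleftrightarrow>
     v \<in> carrier_vec (dim_col A) \<and> v \<noteq> 0\<^sub>v (dim_col A) \<and> A *\<^sub>v v = c \<cdot>\<^sub>v (M *\<^sub>v v)"

definition eig_vec :: "nat \<Rightarrow> nat \<Rightarrow> real vec" where
  "eig_vec N l = vec N (\<lambda>i. sin ((pi / 2 + real l * pi) * (real (Suc i) / real N)))"

definition eig_arg :: "nat \<Rightarrow> nat \<Rightarrow> real" where
  "eig_arg N l = (pi / 2 + real l * pi) * (1 / (2 * real N))"

definition eig_term :: "nat \<Rightarrow> nat \<Rightarrow> nat \<Rightarrow> real" where
  "eig_term N l \<mu> =
     (2 * real l + 1) ^ 4 / (4 * real \<mu> * real N + 2 * real l + 1) ^ 3
   + (2 * real l + 1) ^ 4 / (4 * real \<mu> * real N + 4 * real N - 1 - 2 * real l) ^ 3"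

definition eig_val :: "real \<Rightarrow> nat \<Rightarrow> nat \<Rightarrow> real" where
  "eig_val T N l =
     3 * pi / (2 * T) * (sin (eig_arg N l) ^ 4 / eig_arg N l ^ 4)
     * (1 / (2 + cos (2 * eig_arg N l))) * (\<Sum>\<mu>. eig_term N l \<mu>)"

end

theory Submission
  imports Defs "HOL-Analysis.Equivalence_Lebesgue_Henstock_Integration"
begin

text \<open>On the sines \<open>sin (freq T k * t)\<close> the modified Hilbert transformation is the substitution of cosines for
sines, and integration by parts turns \<open>\<langle>\<partial>\<^sub>t \<phi>\<^sub>i, cos (freq T k * t)\<rangle>\<close> into \<open>freq T k\<close> times the
sine integral of \<open>\<phi>\<^sub>i\<close> (\<open>deriv_hat_cos\<close>).  Hence the stiffness matrix is a series of rank-one matrices,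
one for each frequency \<open>k\<close>, built from the sine coefficients of the hat functions
(\<open>stiffness_entry_sums\<close>).

The sine coefficients of the hat functions are, up to a factor depending on \<open>k\<close> only, the values of the
sine at the mesh points, weighted by \<open>1 / 2\<close> at the end point \<open>T\<close>
(\<open>sine_fourier_coeff_hat\<close>).  The first \<open>N\<close> sampled sines are orthogonal for exactly these
weights (\<open>node_sin_orthogonal\<close>), and a sampled sine of higher frequency coincides up to sign with one of
them (\<open>node_sin_aliasing\<close>).  So each rank-one matrix maps the sampled sine \<open>l\<close> either to \<open>0\<close> or, when \<open>k\<close>
is an alias of \<open>l\<close>, to a multiple of the weighted sampled sine \<open>l\<close>; summing over the aliases
\<open>2 * N * \<mu> + l\<close> and \<open>2 * N * \<mu> + 2 * N - 1 - l\<close> gives the series in the eigenvalue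
(\<open>stiffness_node_sin_sums\<close>).  The tridiagonal mass matrix also maps the sampled sine to a positive multiple of the
weighted sampled sine (\<open>mass_node_sin\<close>), so the weights cancel in the generalized eigenvalue problem.

Weighted orthogonality also makes the \<open>N\<close> eigenvectors a basis (\<open>eig_vec_basis\<close>), in which the
equation decouples into scalar ones (\<open>gen_eigenpair_node_sin_iff\<close>).  This identifies all eigenspaces.\<close>

section \<open>Sines sampled at the mesh points\<close>

definition node_sin :: "nat \<Rightarrow> nat \<Rightarrow> nat \<Rightarrow> real" where
  "node_sin N k i = sin ((pi / 2 + real k * pi) * (real i / real N))"

text \<open>Trapezoidal weights.  The hat function of the end point \<open>T\<close> has only half of its support
inside the interval, and this factor \<open>1 / 2\<close> is the only effect that the boundary has.\<close>

definition node_wt :: "nat \<Rightarrow> nat \<Rightarrow> real" where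
  "node_wt N i = (if i = N then 1 / 2 else 1)"

lemma sum_node_wt:
  assumes "N \<ge> 1"
  shows "(\<Sum>i = 1..N. node_wt N i * f i) = (\<Sum>i = 1..N. f i) - f N / 2"
proof -
  have "(\<Sum>i = 1..N. node_wt N i * f i) = (\<Sum>i = 1..N. f i - (if i = N then f N / 2 else 0))"
    by (rule sum.cong) (auto simp: node_wt_def)
  also have "\<dots> = (\<Sum>i = 1..N. f i) - f N / 2"
    using assms by (simp add: sum_subtractf sum.delta)
  finally show ?thesis .
qed

lemma sum_cos_telescope:
  "2 * sin (\<theta> / 2) * (\<Sum>i = 1..n. cos (real i * \<theta>)) = sin ((real n + 1 / 2) * \<theta>) - sin (\<theta> / 2)"
proof (induction n)
  case (Suc n)
  have "2 * sin (\<theta> / 2) * cos (real (Suc n) * \<theta>)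
      = sin ((real (Suc n) + 1 / 2) * \<theta>) - sin ((real n + 1 / 2) * \<theta>)"
  proof -
    have a: "(real (Suc n) + 1 / 2) * \<theta> = real (Suc n) * \<theta> + \<theta> / 2"
      "(real n + 1 / 2) * \<theta> = real (Suc n) * \<theta> - \<theta> / 2"
      by (simp_all add: algebra_simps)
    show ?thesis unfolding a sin_add sin_diff by simp
  qed
  with Suc show ?case by (simp add: algebra_simps)
qed simp

text \<open>The sum is half of a Dirichlet kernel.  Halving the last summand cancels the part that depends on
the parity of \<open>m\<close>, so that the value is the same for all \<open>m\<close>; a product of two sampled sines is
a difference of two such cosines, and orthogonality follows.\<close>

lemma node_wt_sum_cos:
  assumes "N \<ge> 1" "0 < m" "m < 2 * N"
  shows "(\<Sum>i = 1..N. node_wt N i * cos (real i * (real m * pi / real N))) = - 1 / 2"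
proof -
  define \<theta> where "\<theta> = real m * pi / real N"
  have N\<theta>: "real N * \<theta> = real m * pi" using assms by (simp add: \<theta>_def)
  have "\<theta> / 2 < pi" using assms by (simp add: \<theta>_def field_simps)
  moreover have "\<theta> / 2 > 0" using assms by (simp add: \<theta>_def)
  ultimately have s: "sin (\<theta> / 2) > 0" by (rule sin_gt_zero[rotated])
  have "(real N + 1 / 2) * \<theta> = real m * pi + \<theta> / 2" using N\<theta> by (simp add: algebra_simps)
  then have "2 * sin (\<theta> / 2) * (\<Sum>i = 1..N. cos (real i * \<theta>))
      = cos (real m * pi) * sin (\<theta> / 2) - sin (\<theta> / 2)"
    unfolding sum_cos_telescope by (simp add: sin_add)
  also have "\<dots> = 2 * sin (\<theta> / 2) * ((cos (real N * \<theta>) - 1) / 2)"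
    unfolding N\<theta> by (simp add: algebra_simps)
  finally have "(\<Sum>i = 1..N. cos (real i * \<theta>)) = (cos (real N * \<theta>) - 1) / 2"
    using s by simp
  then show ?thesis
    unfolding \<theta>_def[symmetric] sum_node_wt[OF assms(1)] by (simp add: field_simps)
qed

lemma node_sin_mult:
  "node_sin N k i * node_sin N l i =
     (cos (real i * ((real k - real l) * pi / real N))
      - cos (real i * (real (k + l + 1) * pi / real N))) / 2"
proof -
  let ?x = "(pi / 2 + real k * pi) * (real i / real N)"
  let ?y = "(pi / 2 + real l * pi) * (real i / real N)"
  have "real i * ((real k - real l) * pi / real N) = ?x - ?y"
       "real i * (real (k + l + 1) * pi / real N) = ?x + ?y"
    by (simp_all add: algebra_simps add_divide_distrib diff_divide_distrib)
  then show ?thesis unfolding node_sin_def by (simp add: cos_add cos_diff)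
qed

lemma node_sin_orthogonal:
  assumes "k < N" "l < N"
  shows "(\<Sum>i = 1..N. node_wt N i * (node_sin N k i * node_sin N l i))
       = (if k = l then real N / 2 else 0)"
proof -
  have N: "N \<ge> 1" using assms by simp
  have C: "(\<Sum>i = 1..N. node_wt N i * (node_sin N k i * node_sin N l i))
    = ((\<Sum>i = 1..N. node_wt N i * cos (real i * ((real k - real l) * pi / real N)))
       - (\<Sum>i = 1..N. node_wt N i * cos (real i * (real (k + l + 1) * pi / real N)))) / 2"
    unfolding node_sin_mult by (simp add: sum_subtractf sum_divide_distrib algebra_simps diff_divide_distrib)
  have B: "(\<Sum>i = 1..N. node_wt N i * cos (real i * (real (k + l + 1) * pi / real N))) = - 1 / 2"
    using assms by (intro node_wt_sum_cos) auto
  have "(\<Sum>i = 1..N. node_wt N i * cos (real i * ((real k - real l) * pi / real N)))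
      = (if k = l then real N - 1 / 2 else - 1 / 2)"
  proof (cases "k = l")
    case True
    then show ?thesis using sum_node_wt[OF N, of "\<lambda>_. 1"] by simp
  next
    case False
    define m where "m = (if k > l then k - l else l - k)"
    have "cos (real i * ((real k - real l) * pi / real N)) = cos (real i * (real m * pi / real N))" for i
    proof (cases "k > l")
      case False
      then have "real i * ((real k - real l) * pi / real N) = - (real i * (real m * pi / real N))"
        by (simp add: m_def of_nat_diff algebra_simps diff_divide_distrib)
      then show ?thesis by (simp only: cos_minus)
    qed (simp add: m_def of_nat_diff)
    moreover have "0 < m" "m < 2 * N" using False assms by (auto simp: m_def)
    ultimately show ?thesis using node_wt_sum_cos[OF N, of m] False by simp
  qed
  then show ?thesis unfolding C B by simp
qed

lemma sin_add_of_nat_2pi: "sin (x + real n * (2 * pi)) = sin x"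
proof -
  have "real n * (2 * pi) = 2 * real n * pi" by simp
  then show ?thesis by (simp only: sin_add cos_2npi sin_2npi mult_1_right mult_zero_right add_0_right)
qed

text \<open>Periodicity and reflection together are the aliasing of sampled sines: on the mesh, the sine of any
number \<open>k\<close> is plus or minus the sine of a number below \<open>N\<close>.\<close>

lemma node_sin_periodic:
  assumes "N \<ge> 1"
  shows "node_sin N (2 * N * \<mu> + k) i = node_sin N k i"
proof -
  have "(pi / 2 + real (2 * N * \<mu> + k) * pi) * (real i / real N)
      = (pi / 2 + real k * pi) * (real i / real N) + real (\<mu> * i) * (2 * pi)"
    using assms by (simp add: field_simps)
  then show ?thesis unfolding node_sin_def
    by (simp only: sin_add_of_nat_2pi)
qed

lemma node_sin_reflect:
  assumes "k < 2 * N"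
  shows "node_sin N (2 * N - 1 - k) i = - node_sin N k i"
proof -
  have "(pi / 2 + real (2 * N - 1 - k) * pi) * (real i / real N)
      = - ((pi / 2 + real k * pi) * (real i / real N)) + real i * (2 * pi)"
    using assms by (simp add: of_nat_diff field_simps)
  then show ?thesis unfolding node_sin_def
    by (simp only: sin_add_of_nat_2pi sin_minus)
qed

lemma cos_half_odd_pi: "cos (pi / 2 + real l * pi) = 0"
  by (simp add: cos_add)

lemma node_sin_0 [simp]: "node_sin N l 0 = 0"
  by (simp add: node_sin_def)

lemma node_sin_end:
  assumes "N \<ge> 1"
  shows "node_sin N l N = (-1) ^ l"
  using assms by (simp add: node_sin_def sin_add)

text \<open>The sampled sine solves a three-term recurrence, which at the end point, where the cosine vanishes,
reduces to a two-term one.  Through these recurrences the tridiagonal mass matrix acts on it.\<close>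

lemma node_sin_neighbours:
  "node_sin N l i + node_sin N l (Suc (Suc i)) = 2 * cos (2 * eig_arg N l) * node_sin N l (Suc i)"
proof -
  have "(pi / 2 + real l * pi) * (real (Suc (Suc i)) / real N)
     = (pi / 2 + real l * pi) * (real (Suc i) / real N) + 2 * eig_arg N l"
    "(pi / 2 + real l * pi) * (real i / real N)
     = (pi / 2 + real l * pi) * (real (Suc i) / real N) - 2 * eig_arg N l"
    by (simp_all add: eig_arg_def add_divide_distrib algebra_simps)
  then show ?thesis unfolding node_sin_def by (simp add: sin_add sin_diff)
qed

lemma node_sin_end_neighbour:
  assumes "N \<ge> 1"
  shows "node_sin N l (N - 1) = cos (2 * eig_arg N l) * node_sin N l N"
proof -
  have "(pi / 2 + real l * pi) * (real (N - 1) / real N) = (pi / 2 + real l * pi) - 2 * eig_arg N l"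
    using assms by (simp add: eig_arg_def of_nat_diff field_simps)
  then show ?thesis using assms unfolding node_sin_def
    by (simp add: sin_diff cos_half_odd_pi)
qed

section \<open>Integrals of hat functions against sines and cosines\<close>

lemma LINT_open_interval_eq:
  fixes f :: "real \<Rightarrow> real"
  assumes "set_integrable lborel {0<..<T} f" "(f has_integral I) {0..T}"
  shows "(LINT t:{0<..<T}|lborel. f t) = I"
  using set_borel_integral_eq_integral(2)[OF assms(1)] assms(2)
  by (metis has_integral_Icc_iff_Ioo integral_unique)

lemma continuous_set_integrable:
  fixes f :: "real \<Rightarrow> real"
  assumes "continuous_on {0..T} f"
  shows "set_integrable lborel {0<..<T} f"
  by (rule set_integrable_subset[OF borel_integrable_atLeastAtMost'[OF assms]]) auto

lemma cos_freq_at_end: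
  assumes "T > 0"
  shows "cos (freq T k * T) = 0"
  using assms cos_half_odd_pi[of k] by (simp add: freq_def)

lemma freq_pos: "T > 0 \<Longrightarrow> freq T k > 0"
  by (simp add: freq_def add_pos_nonneg)

lemma sin_freq_mesh_pt: "T > 0 \<Longrightarrow> sin (freq T k * mesh_pt T N j) = node_sin N k j"
  by (simp add: freq_def mesh_pt_def node_sin_def)

lemma freq_mesh_width: "T > 0 \<Longrightarrow> freq T k * (T / real N) = 2 * eig_arg N k"
proof -
  assume "T > 0"
  moreover define X where "X = pi / 2 + real k * pi"
  ultimately show ?thesis unfolding freq_def eig_arg_def X_def[symmetric] by simp
qed

lemma abs_shift_has_real_derivative:
  fixes a t :: real
  assumes "t \<noteq> a"
  shows "((\<lambda>t. \<bar>t - a\<bar>) has_real_derivative sgn (t - a)) (at t)"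
proof -
  have "((\<lambda>t. sgn (t - a)) has_real_derivative 0) (at t)"
  proof (rule has_field_derivative_transform_within_open)
    show "((\<lambda>_. sgn (t - a)) has_real_derivative 0) (at t)" by simp
    show "open (if t > a then {a<..} else {..<a})" by simp
    show "t \<in> (if t > a then {a<..} else {..<a})" using assms by auto
    show "\<And>x. x \<in> (if t > a then {a<..} else {..<a}) \<Longrightarrow> sgn (t - a) = sgn (x - a)"
      using assms by (auto split: if_splits)
  qed
  moreover have "((\<lambda>t. t - a) has_real_derivative 1) (at t)"
    by (auto intro!: derivative_eq_intros)
  ultimately have "((\<lambda>t. sgn (t - a) * (t - a)) has_real_derivative sgn (t - a)) (at t)"
    using DERIV_mult by fastforce
  moreover have "(\<lambda>t. sgn (t - a) * (t - a)) = (\<lambda>t. \<bar>t - a\<bar>)"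
    by (rule ext) (simp add: sgn_mult_self_eq abs_sgn mult.commute)
  ultimately show ?thesis by simp
qed

text \<open>A hat function is a second difference of absolute values, so its sine coefficients are second
differences in \<open>a\<close> of this integral.  At an interior node the term that is linear in \<open>a\<close> then drops out.\<close>

lemma abs_times_sin_has_integral:
  fixes a w T :: real
  assumes "0 \<le> a" "a \<le> T" "w \<noteq> 0" "cos (w * T) = 0"
  shows "((\<lambda>t. \<bar>t - a\<bar> * sin (w * t)) has_integral
           (sin (w * T) - 2 * sin (w * a)) / w\<^sup>2 + a / w) {0..T}"
proof -
  have I: "((\<lambda>t. (a - t) * sin (w * t)) has_integral a / w - sin (w * a) / w\<^sup>2) {0..a}"
  proof -
    have "((\<lambda>t. (a - t) * sin (w * t)) has_integral
        (- (a - a) * cos (w * a) / w - sin (w * a) / w\<^sup>2) - (- (a - 0) * cos (w * 0) / w - sin (w * 0) / w\<^sup>2)) {0..a}"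
      using assms
      by (intro fundamental_theorem_of_calculus)
         (auto intro!: derivative_eq_intros
            simp flip: has_real_derivative_iff_has_vector_derivative simp: field_simps power2_eq_square)
    then show ?thesis by simp
  qed
  have J: "((\<lambda>t. (t - a) * sin (w * t)) has_integral (sin (w * T) - sin (w * a)) / w\<^sup>2) {a..T}"
  proof -
    have "((\<lambda>t. (t - a) * sin (w * t)) has_integral
        (- (T - a) * cos (w * T) / w + sin (w * T) / w\<^sup>2) - (- (a - a) * cos (w * a) / w + sin (w * a) / w\<^sup>2)) {a..T}"
      using assms(1,2,3)
      by (intro fundamental_theorem_of_calculus)
         (auto intro!: derivative_eq_intros
            simp flip: has_real_derivative_iff_has_vector_derivative simp: field_simps power2_eq_square)
    then show ?thesis using assms by (simp add: diff_divide_distrib)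
  qed
  have I': "((\<lambda>t. \<bar>t - a\<bar> * sin (w * t)) has_integral a / w - sin (w * a) / w\<^sup>2) {0..a}"
    using I by (rule has_integral_eq[rotated]) auto
  have J': "((\<lambda>t. \<bar>t - a\<bar> * sin (w * t)) has_integral (sin (w * T) - sin (w * a)) / w\<^sup>2) {a..T}"
    using J by (rule has_integral_eq[rotated]) auto
  have "a / w - sin (w * a) / w\<^sup>2 + (sin (w * T) - sin (w * a)) / w\<^sup>2
      = (sin (w * T) - 2 * sin (w * a)) / w\<^sup>2 + a / w"
    by (simp add: diff_divide_distrib)
  with has_integral_combine[OF assms(1,2) I' J'] show ?thesis by simp
qed

lemma hat_eq_second_difference:
  assumes "T > 0" "N \<ge> 1"
  defines "h \<equiv> T / real N"
  shows "hat T N k t = (\<bar>t - (mesh_pt T N k - h)\<bar> - 2 * \<bar>t - mesh_pt T N k\<bar>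
           + \<bar>t - (mesh_pt T N k + h)\<bar>) / (2 * h)"
proof -
  have h: "h > 0" using assms by (simp add: h_def)
  define x where "x = t - mesh_pt T N k"
  have "max 0 (1 - \<bar>x\<bar> / h) = (\<bar>x + h\<bar> - 2 * \<bar>x\<bar> + \<bar>x - h\<bar>) / (2 * h)"
    using h by (auto simp: max_def abs_if field_simps)
  then show ?thesis unfolding hat_def h_def[symmetric] x_def by (simp add: algebra_simps)
qed

lemma hat_continuous: "T > 0 \<Longrightarrow> N \<ge> 1 \<Longrightarrow> continuous_on A (hat T N k)"
  unfolding hat_def by (intro continuous_intros) auto

text \<open>The second difference of the sampled sine is a multiple of itself, with a factor that depends only
on the frequency.  For the last hat function, only half of which lies in \<open>{0..T}\<close>, the boundary condition
\<open>cos (freq T k * T) = 0\<close> turns the first difference that is left into half of that second difference.\<close>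

lemma hat_times_sin_has_integral:
  assumes "T > 0" "N \<ge> 1" "j \<in> {1..N}"
  defines "h \<equiv> T / real N"
  shows "((\<lambda>t. hat T N j t * sin (freq T k * t)) has_integral
     4 * (sin (eig_arg N k))\<^sup>2 / (h * (freq T k)\<^sup>2) * (node_wt N j * node_sin N k j)) {0..T}"
proof -
  define w where "w = freq T k"
  define x where "x = mesh_pt T N j"
  have h: "h > 0" and hT: "real N * h = T" using assms by (simp_all add: h_def)
  have w: "w > 0" "cos (w * T) = 0" using assms by (simp_all add: w_def freq_pos cos_freq_at_end)
  have xh: "x = real j * h" by (simp add: x_def mesh_pt_def h_def)
  have x: "0 \<le> x - h" "x \<le> T"
    using assms(3) h mult_right_mono[of 1 "real j" h] mult_right_mono[of "real j" "real N" h]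
    by (auto simp: xh hT[symmetric])
  have wh: "cos (w * h) = 1 - 2 * (sin (eig_arg N k))\<^sup>2"
    unfolding w_def h_def freq_mesh_width[OF assms(1)] cos_double_sin ..
  have sx: "sin (w * x) = node_sin N k j" using sin_freq_mesh_pt[OF assms(1)] by (simp add: w_def x_def)
  note A = abs_times_sin_has_integral[OF _ _ _ w(2)]
  show ?thesis
  proof (cases "j = N")
    case False
    then have "real j + 1 \<le> real N" using assms(3) by auto
    then have xhT: "x + h \<le> T" using h mult_right_mono[of "real j + 1" "real N" h]
      by (simp add: xh hT[symmetric] algebra_simps)
    let ?I = "\<lambda>a. (sin (w * T) - 2 * sin (w * a)) / w\<^sup>2 + a / w"
    have "((\<lambda>t. (\<bar>t - (x - h)\<bar> * sin (w * t) - 2 * (\<bar>t - x\<bar> * sin (w * t))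
        + \<bar>t - (x + h)\<bar> * sin (w * t)) / (2 * h)) has_integral
        (?I (x - h) - 2 * ?I x + ?I (x + h)) / (2 * h)) {0..T}"
      using x xhT h w by (intro has_integral_divide has_integral_add has_integral_diff
          has_integral_mult_right A) auto
    moreover have "(\<lambda>t. (\<bar>t - (x - h)\<bar> * sin (w * t) - 2 * (\<bar>t - x\<bar> * sin (w * t))
        + \<bar>t - (x + h)\<bar> * sin (w * t)) / (2 * h)) = (\<lambda>t. hat T N j t * sin (w * t))"
      unfolding hat_eq_second_difference[OF assms(1,2)] x_def h_def
      by (simp add: algebra_simps)
    moreover have "(?I (x - h) - 2 * ?I x + ?I (x + h)) / (2 * h)
      = (2 * sin (w * x) - sin (w * (x - h)) - sin (w * (x + h))) / (h * w\<^sup>2)"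
      using h w by (simp add: field_simps power2_eq_square)
    moreover have "2 * sin (w * x) - sin (w * (x - h)) - sin (w * (x + h))
       = 2 * sin (w * x) * (1 - cos (w * h))"
      by (simp add: algebra_simps sin_add sin_diff)
    ultimately show ?thesis using False unfolding wh sx
      by (simp add: w_def node_wt_def mult_ac)
  next
    case True
    then have xT: "x = T" by (simp add: xh hT)
    let ?I = "\<lambda>a. (sin (w * T) - 2 * sin (w * a)) / w\<^sup>2 + a / w"
    have S: "((\<lambda>t. sin (w * t)) has_integral 1 / w) {0..T}"
    proof -
      have "((\<lambda>t. sin (w * t)) has_integral - cos (w * T) / w - (- cos (w * 0) / w)) {0..T}"
        using w(1) assms(1)
        by (intro fundamental_theorem_of_calculus)
           (auto intro!: derivative_eq_intros simp flip: has_real_derivative_iff_has_vector_derivative)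
      then show ?thesis using w by simp
    qed
    \<comment> \<open>On \<open>{0..T}\<close> the absolute value centred at \<open>T + h\<close> is affine and merges with the one centred at \<open>T\<close>.\<close>
    have "((\<lambda>t. (\<bar>t - (T - h)\<bar> * sin (w * t) - \<bar>t - T\<bar> * sin (w * t)) / (2 * h) + sin (w * t) / 2)
      has_integral (?I (T - h) - ?I T) / (2 * h) + 1 / w / 2) {0..T}"
      using x h w xT by (intro has_integral_divide has_integral_add has_integral_diff A S) auto
    then have "((\<lambda>t. hat T N j t * sin (w * t)) has_integral (?I (T - h) - ?I T) / (2 * h) + 1 / w / 2) {0..T}"
      by (rule has_integral_eq[rotated], unfold hat_eq_second_difference[OF assms(1,2)])
         (use h in \<open>simp add: h_def[symmetric] x_def[symmetric] xT field_simps\<close>)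
    moreover have "(?I (T - h) - ?I T) / (2 * h) + 1 / w / 2 = (sin (w * T) - sin (w * (T - h))) / (h * w\<^sup>2)"
      using h w by (simp add: field_simps power2_eq_square)
    moreover have "sin (w * T) - sin (w * (T - h)) = sin (w * T) * (1 - cos (w * h))"
      using w by (simp add: right_diff_distrib sin_diff)
    ultimately show ?thesis using True sx unfolding wh xT
      by (simp add: w_def node_wt_def mult_ac)
  qed
qed

lemma sine_fourier_coeff_hat:
  assumes "T > 0" "N \<ge> 1" "j \<in> {1..N}"
  shows "sine_fourier_coeff T (hat T N j) k =
    2 / T * (4 * (sin (eig_arg N k))\<^sup>2 / (T / real N * (freq T k)\<^sup>2) * (node_wt N j * node_sin N k j))"
proof -
  have "set_integrable lborel {0<..<T} (\<lambda>t. hat T N j t * sin (freq T k * t))"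
    by (intro continuous_set_integrable continuous_intros hat_continuous assms)
  from LINT_open_interval_eq[OF this hat_times_sin_has_integral[OF assms]]
  show ?thesis unfolding sine_fourier_coeff_def by simp
qed

lemma hat_has_derivative:
  assumes "T > 0" "N \<ge> 1"
  defines "h \<equiv> T / real N"
  assumes "t \<notin> {mesh_pt T N k - h, mesh_pt T N k, mesh_pt T N k + h}"
  shows "(hat T N k has_real_derivative (sgn (t - (mesh_pt T N k - h)) - 2 * sgn (t - mesh_pt T N k)
           + sgn (t - (mesh_pt T N k + h))) / (2 * h)) (at t)"
proof -
  have "hat T N k = (\<lambda>t. (\<bar>t - (mesh_pt T N k - h)\<bar> - 2 * \<bar>t - mesh_pt T N k\<bar>
           + \<bar>t - (mesh_pt T N k + h)\<bar>) / (2 * h))"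
    using hat_eq_second_difference[OF assms(1,2)] by (auto simp: h_def)
  then show ?thesis using assms
    by (auto intro!: derivative_eq_intros abs_shift_has_real_derivative simp: h_def)
qed

lemma deriv_hat_measurable:
  assumes "T > 0" "N \<ge> 1"
  shows "deriv (hat T N k) \<in> borel_measurable borel"
proof -
  define h where "h = T / real N"
  let ?g = "\<lambda>t. (sgn (t - (mesh_pt T N k - h)) - 2 * sgn (t - mesh_pt T N k)
           + sgn (t - (mesh_pt T N k + h))) / (2 * h)"
  show ?thesis
  proof (rule measurable_discrete_difference[of ?g _ _ "{mesh_pt T N k - h, mesh_pt T N k, mesh_pt T N k + h}"])
    show "?g \<in> borel_measurable borel" unfolding sgn_if by measurable
    fix t assume "t \<notin> {mesh_pt T N k - h, mesh_pt T N k, mesh_pt T N k + h}"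
    then show "?g t = deriv (hat T N k) t"
      using DERIV_imp_deriv[OF hat_has_derivative[OF assms, of t k]] by (simp add: h_def)
  qed auto
qed

text \<open>At the three kinks \<open>deriv\<close> is some unspecified number, which is why the bound is only existential.\<close>

lemma deriv_hat_bounded:
  assumes "T > 0" "N \<ge> 1"
  shows "\<exists>B\<ge>0. \<forall>t. \<bar>deriv (hat T N k) t\<bar> \<le> B"
proof -
  define h where "h = T / real N"
  define X where "X = {mesh_pt T N k - h, mesh_pt T N k, mesh_pt T N k + h}"
  define B where "B = 2 / h + (\<Sum>t\<in>X. \<bar>deriv (hat T N k) t\<bar>)"
  have h: "h > 0" using assms by (simp add: h_def)
  have "\<bar>deriv (hat T N k) t\<bar> \<le> B" for t
  proof (cases "t \<in> X")
    case True
    then have "\<bar>deriv (hat T N k) t\<bar> \<le> (\<Sum>t\<in>X. \<bar>deriv (hat T N k) t\<bar>)"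
      by (intro member_le_sum) (auto simp: X_def)
    with h show ?thesis by (simp add: B_def add_increasing)
  next
    case False
    let ?n = "sgn (t - (mesh_pt T N k - h)) - 2 * sgn (t - mesh_pt T N k) + sgn (t - (mesh_pt T N k + h))"
    have "deriv (hat T N k) t = ?n / (2 * h)"
      using DERIV_imp_deriv[OF hat_has_derivative[OF assms, of t k]] False by (simp add: h_def X_def)
    moreover have "\<bar>?n\<bar> \<le> 4" by (auto simp: sgn_if)
    then have "\<bar>?n\<bar> / (2 * h) \<le> 4 / (2 * h)" using h by (intro divide_right_mono) auto
    ultimately have "\<bar>deriv (hat T N k) t\<bar> \<le> 2 / h" using h by (simp add: abs_mult)
    then show ?thesis unfolding B_def by (simp add: add_increasing2 sum_nonneg)
  qed
  moreover have "B \<ge> 0" using h by (simp add: B_def sum_nonneg)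
  ultimately show ?thesis by blast
qed

lemma bounded_set_integrable:
  fixes f :: "real \<Rightarrow> real"
  assumes "f \<in> borel_measurable borel" "\<And>t. t \<in> {0<..<T} \<Longrightarrow> \<bar>f t\<bar> \<le> B"
  shows "set_integrable lborel {0<..<T} f"
proof (rule set_integrable_bound)
  show "set_integrable lborel {0<..<T} (\<lambda>_. B)" by (intro continuous_set_integrable) simp
  show "set_borel_measurable lborel {0<..<T} f"
    unfolding set_borel_measurable_def using assms(1) by measurable
qed (use assms(2) in force)

text \<open>Integration by parts.  Both boundary terms vanish: the hat function is \<open>0\<close> at \<open>0\<close>, the cosine at \<open>T\<close>.
This is what makes the modified Hilbert transformation the right test function: sine coefficients are
paired with sine coefficients, with the positive weight \<open>freq T k\<close>.\<close>

lemma deriv_hat_cos: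
  assumes "T > 0" "N \<ge> 1" "i \<in> {1..N}"
  shows "L2_inner T (deriv (hat T N i)) (\<lambda>t. cos (freq T k * t))
       = freq T k * (T / 2) * sine_fourier_coeff T (hat T N i) k"
proof -
  define w where "w = freq T k"
  define J where "J = (LINT t:{0<..<T}|lborel. hat T N i t * sin (w * t))"
  define X where "X = {mesh_pt T N i - T / real N, mesh_pt T N i, mesh_pt T N i + T / real N}"
  have int: "set_integrable lborel {0<..<T} (\<lambda>t. hat T N i t * sin (w * t))"
    by (intro continuous_set_integrable continuous_intros hat_continuous assms)
  have J: "((\<lambda>t. hat T N i t * sin (w * t)) has_integral J) {0..T}"
    using hat_times_sin_has_integral[OF assms, of k] LINT_open_interval_eq[OF int, folded J_def]
    unfolding w_def by metis
  have "((\<lambda>t. deriv (hat T N i) t * cos (w * t) - w * (hat T N i t * sin (w * t)))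
      has_integral hat T N i T * cos (w * T) - hat T N i 0 * cos (w * 0)) {0..T}"
  proof (rule fundamental_theorem_of_calculus_interior_strong[of X])
    fix t assume "t \<in> {0<..<T} - X"
    then have "(hat T N i has_real_derivative deriv (hat T N i) t) (at t)"
      using hat_has_derivative[OF assms(1,2), of t i] DERIV_imp_deriv by (fastforce simp: X_def)
    then show "((\<lambda>t. hat T N i t * cos (w * t)) has_vector_derivative
        deriv (hat T N i) t * cos (w * t) - w * (hat T N i t * sin (w * t))) (at t)"
      by (auto intro!: derivative_eq_intros simp flip: has_real_derivative_iff_has_vector_derivative)
  qed (use assms in \<open>auto simp: X_def intro!: continuous_intros hat_continuous\<close>)
  moreover have "cos (w * T) = 0" using assms by (simp add: w_def cos_freq_at_end)
  moreover have "hat T N i 0 = 0" using hat_mesh_pt[OF assms(1,2), of i 0] assms(3)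
    by (simp add: mesh_pt_def)
  ultimately have "((\<lambda>t. deriv (hat T N i) t * cos (w * t) - w * (hat T N i t * sin (w * t)))
      has_integral 0) {0..T}" by simp
  from has_integral_add[OF this has_integral_mult_right[OF J, of w]]
  have "((\<lambda>t. deriv (hat T N i) t * cos (w * t)) has_integral w * J) {0..T}" by simp
  moreover obtain B where B: "B \<ge> 0" "\<And>t. \<bar>deriv (hat T N i) t\<bar> \<le> B"
    using deriv_hat_bounded[OF assms(1,2)] by blast
  have "set_integrable lborel {0<..<T} (\<lambda>t. deriv (hat T N i) t * cos (w * t))"
  proof (rule bounded_set_integrable[where B = B])
    show "(\<lambda>t. deriv (hat T N i) t * cos (w * t)) \<in> borel_measurable borel"
      using deriv_hat_measurable[OF assms(1,2)] by measurable
    show "\<bar>deriv (hat T N i) t * cos (w * t)\<bar> \<le> B" for t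
      using mult_mono[OF B(2)[of t] abs_cos_le_one[of "w * t"]] B(1) by (simp add: abs_mult)
  qed
  ultimately have "L2_inner T (deriv (hat T N i)) (\<lambda>t. cos (w * t)) = w * J"
    unfolding L2_inner_def using LINT_open_interval_eq by blast
  then show ?thesis using assms unfolding sine_fourier_coeff_def J_def w_def by simp
qed

section \<open>The mass matrix\<close>

lemma pl_product_cell_has_integral:
  assumes "T > 0" "N \<ge> 1" "p \<in> pl_space T N" "q \<in> pl_space T N" "m < N"
  defines "P \<equiv> \<lambda>i. p (mesh_pt T N i)" and "Q \<equiv> \<lambda>i. q (mesh_pt T N i)"
  shows "((\<lambda>t. p t * q t) has_integral T / real N / 6 *
      (2 * P m * Q m + P m * Q (Suc m) + P (Suc m) * Q m + 2 * P (Suc m) * Q (Suc m)))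
      {mesh_pt T N m..mesh_pt T N (Suc m)}"
proof -
  define h where "h = T / real N"
  have h: "h > 0" using assms by (simp add: h_def)
  define x where "x = mesh_pt T N m"
  have y: "mesh_pt T N (Suc m) = x + h" by (simp add: x_def mesh_pt_def h_def add_divide_distrib algebra_simps)
  obtain a b where p: "\<And>t. t \<in> {x..x + h} \<Longrightarrow> p t = a + b * t"
    using assms(3,5) unfolding pl_space_def x_def y[unfolded x_def, symmetric] by blast
  obtain c d where q: "\<And>t. t \<in> {x..x + h} \<Longrightarrow> q t = c + d * t"
    using assms(4,5) unfolding pl_space_def x_def y[unfolded x_def, symmetric] by blast
  define F where "F t = a * c * t + (a * d + b * c) * t ^ 2 / 2 + b * d * t ^ 3 / 3" for t
  have "((\<lambda>t. (a + b * t) * (c + d * t)) has_integral F (x + h) - F x) {x..x + h}"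
    using h unfolding F_def
    by (intro fundamental_theorem_of_calculus)
       (auto intro!: derivative_eq_intros simp flip: has_real_derivative_iff_has_vector_derivative
         simp: algebra_simps power2_eq_square)
  then have "((\<lambda>t. p t * q t) has_integral F (x + h) - F x) {x..x + h}"
    by (rule has_integral_eq[rotated]) (simp add: p q)
  moreover have "P m = a + b * x" "P (Suc m) = a + b * (x + h)" "Q m = c + d * x" "Q (Suc m) = c + d * (x + h)"
    using p[of x] p[of "x + h"] q[of x] q[of "x + h"] h
    by (simp_all add: P_def Q_def y flip: x_def)
  then have "F (x + h) - F x = h / 6 *
      (2 * P m * Q m + P m * Q (Suc m) + P (Suc m) * Q m + 2 * P (Suc m) * Q (Suc m))"
    unfolding F_def by (simp add: field_simps power2_eq_square power3_eq_cube)
  ultimately show ?thesis unfolding y x_def[symmetric] h_def[symmetric] by simp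
qed

lemma L2_inner_pl_space:
  assumes "T > 0" "N \<ge> 1" "p \<in> pl_space T N" "q \<in> pl_space T N"
  defines "P \<equiv> \<lambda>i. p (mesh_pt T N i)" and "Q \<equiv> \<lambda>i. q (mesh_pt T N i)"
  shows "L2_inner T p q = T / real N / 6 *
    (\<Sum>m<N. 2 * P m * Q m + P m * Q (Suc m) + P (Suc m) * Q m + 2 * P (Suc m) * Q (Suc m))"
proof -
  let ?c = "\<lambda>m. 2 * P m * Q m + P m * Q (Suc m) + P (Suc m) * Q m + 2 * P (Suc m) * Q (Suc m)"
  have "((\<lambda>t. p t * q t) has_integral (\<Sum>m<n. T / real N / 6 * ?c m)) {0..mesh_pt T N n}" if "n \<le> N" for n
    using that
  proof (induction n)
    case 0
    then show ?case by (simp add: mesh_pt_def has_integral_refl)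
  next
    case (Suc n)
    have "((\<lambda>t. p t * q t) has_integral T / real N / 6 * ?c n) {mesh_pt T N n..mesh_pt T N (Suc n)}"
      unfolding P_def Q_def using Suc.prems by (intro pl_product_cell_has_integral assms(1-4)) simp
    moreover have "0 \<le> mesh_pt T N n" "mesh_pt T N n \<le> mesh_pt T N (Suc n)"
      using assms(1) by (auto simp: mesh_pt_def intro!: divide_right_mono mult_right_mono)
    ultimately show ?case using has_integral_combine[OF _ _ Suc.IH] Suc.prems by simp
  qed
  from this[of N] have "((\<lambda>t. p t * q t) has_integral T / real N / 6 * (\<Sum>m<N. ?c m)) {0..T}"
    using assms(2) by (simp add: mesh_pt_def flip: sum_distrib_left sum_divide_distrib)
  moreover have "set_integrable lborel {0<..<T} (\<lambda>t. p t * q t)"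
    using assms(3,4) by (intro continuous_set_integrable continuous_intros) (auto simp: pl_space_def)
  ultimately show ?thesis unfolding L2_inner_def using LINT_open_interval_eq by blast
qed

lemma L2_inner_hat_right:
  assumes "T > 0" "N \<ge> 1" "p \<in> pl_space T N" "j \<in> {1..N}"
  defines "P \<equiv> \<lambda>i. p (mesh_pt T N i)"
  shows "L2_inner T p (hat T N j) = T / real N / 6 *
    (P (j - 1) + 2 * P j + (if j < N then 2 * P j + P (Suc j) else 0))"
proof -
  define Q where "Q i = (if i = j then 1 else 0 :: real)" for i
  have Q: "hat T N j (mesh_pt T N i) = Q i" for i
    using hat_mesh_pt[OF assms(1,2)] by (simp add: Q_def)
  have jj: "Suc m = j \<longleftrightarrow> m = j - 1" for m using assms(4) by auto
  have "(\<Sum>m<N. 2 * P m * Q m + P m * Q (Suc m) + P (Suc m) * Q m + 2 * P (Suc m) * Q (Suc m))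
      = (\<Sum>m<N. (if m = j then 2 * P j + P (Suc j) else 0))
        + (\<Sum>m<N. (if m = j - 1 then P (j - 1) + 2 * P j else 0))"
    unfolding sum.distrib[symmetric] using assms(4) by (intro sum.cong) (auto simp: Q_def jj)
  also have "\<dots> = P (j - 1) + 2 * P j + (if j < N then 2 * P j + P (Suc j) else 0)"
    using assms(4) by auto
  finally show ?thesis
    using L2_inner_pl_space[OF assms(1-3) hat_in_pl_space[OF assms(1,2,4)]] by (simp add: Q P_def)
qed

text \<open>The rows of the mass matrix are \<open>h / 6\<close> times \<open>(1, 4, 1)\<close>, with last row \<open>(1, 2)\<close>, when the node \<open>0\<close>,
at which the sampled sine vanishes, is counted in.  The recurrences for the sampled sine then give an
eigenvector up to the trapezoidal weight.\<close>

lemma mass_node_sin: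
  assumes "T > 0" "N \<ge> 1" "j \<in> {1..N}"
  shows "(\<Sum>i = 1..N. L2_inner T (hat T N i) (hat T N j) * node_sin N l i)
    = T / real N / 3 * (2 + cos (2 * eig_arg N l)) * (node_wt N j * node_sin N l j)"
proof -
  define S where "S = node_sin N l"
  have H: "L2_inner T (hat T N i) (hat T N j) = T / real N / 6 * ((if j - 1 = i then 1 else 0)
      + 2 * (if j = i then 1 else 0) + (if j < N then 2 * (if j = i then 1 else 0) + (if Suc j = i then 1 else 0) else 0))"
    if "i \<in> {1..N}" for i
    unfolding L2_inner_hat_right[OF assms(1,2) hat_in_pl_space[OF assms(1,2) that] assms(3)]
      hat_mesh_pt[OF assms(1,2)] ..
  have "(\<Sum>i = 1..N. L2_inner T (hat T N i) (hat T N j) * S i)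
      = (\<Sum>i = 1..N. T / real N / 6 * ((if i = j - 1 then S i else 0)
      + 2 * (if i = j then S i else 0) + (if j < N then 2 * (if i = j then S i else 0) + (if i = Suc j then S i else 0) else 0)))"
    by (rule sum.cong) (auto simp: H)
  also have "\<dots> = T / real N / 6 * ((\<Sum>i = 1..N. if i = j - 1 then S i else 0)
      + 2 * (\<Sum>i = 1..N. if i = j then S i else 0) + (if j < N then 2 * (\<Sum>i = 1..N. if i = j then S i else 0)
      + (\<Sum>i = 1..N. if i = Suc j then S i else 0) else 0))"
    unfolding sum_distrib_left[symmetric] sum.distrib by (cases "j < N") (simp_all only: if_True if_False sum.distrib sum_distrib_left[symmetric] sum.neutral_const)
  also have "(\<Sum>i = 1..N. if i = j - 1 then S i else 0) = S (j - 1)"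
    using assms(3) by (auto simp: S_def)
  also have "(\<Sum>i = 1..N. if i = j then S i else 0) = S j" using assms(3) by auto
  also have "(if j < N then 2 * S j + (\<Sum>i = 1..N. if i = Suc j then S i else 0) else 0)
     = (if j < N then 2 * S j + S (Suc j) else 0)" by auto
  also have "T / real N / 6 * (S (j - 1) + 2 * S j + (if j < N then 2 * S j + S (Suc j) else 0))
     = T / real N / 3 * (2 + cos (2 * eig_arg N l)) * (node_wt N j * S j)"
  proof (cases "j < N")
    case True
    have sixth: "a / 6 * (2 * b * c) = a / 3 * b * c" for a b c :: real by simp
    have "S (j - 1) + S (Suc j) = 2 * cos (2 * eig_arg N l) * S j"
      using node_sin_neighbours[of N l "j - 1"] assms(3) by (simp add: S_def)
    then have "S (j - 1) + 2 * S j + (2 * S j + S (Suc j)) = 2 * (2 + cos (2 * eig_arg N l)) * S j"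
      by (simp add: algebra_simps)
    then have "T / real N / 6 * (S (j - 1) + 2 * S j + (2 * S j + S (Suc j)))
        = T / real N / 3 * (2 + cos (2 * eig_arg N l)) * S j"
      by (simp only: sixth)
    with True show ?thesis by (simp add: node_wt_def)
  next
    case False
    then have "j = N" using assms(3) by simp
    moreover have "S (N - 1) + 2 * S N = (2 + cos (2 * eig_arg N l)) * S N"
      using node_sin_end_neighbour[OF assms(2), of l] by (simp add: S_def algebra_simps)
    ultimately show ?thesis by (simp add: node_wt_def)
  qed
  finally show ?thesis by (simp only: S_def)
qed

section \<open>The modified Hilbert transformation of an absolutely convergent sine series\<close>

lemma sine_fourier_coeff_hat_summable:
  assumes "T > 0" "N \<ge> 1" "j \<in> {1..N}"
  shows "summable (\<lambda>k. \<bar>sine_fourier_coeff T (hat T N j) k\<bar>)"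
proof (rule summable_comparison_test)
  define C where "C = 2 / T * (4 / (T / real N) * (2 * T / pi)\<^sup>2)"
  have "summable (\<lambda>k. inverse (real (Suc k) ^ 2))"
    by (subst summable_Suc_iff, rule inverse_power_summable) simp
  then show "summable (\<lambda>k. C * inverse (real (Suc k) ^ 2))" by (rule summable_mult)
  show "\<exists>n0. \<forall>n\<ge>n0. norm \<bar>sine_fourier_coeff T (hat T N j) n\<bar> \<le> C * inverse (real (Suc n) ^ 2)"
  proof (intro exI[of _ 0] allI impI)
    fix n
    define w where "w = freq T n"
    define s where "s = (sin (eig_arg N n))\<^sup>2 * (node_wt N j * node_sin N n j)"
    have w: "w > 0" using assms by (simp add: w_def freq_pos)
    have "pi / 2 * real (Suc n) / T \<le> w"
      using assms(1) unfolding w_def freq_def by (intro divide_right_mono) (auto simp: algebra_simps)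
    then have "(pi / (2 * T) * real (Suc n))\<^sup>2 \<le> w\<^sup>2"
      using assms(1) by (intro power_mono) (auto simp: field_simps)
    then have "1 / w\<^sup>2 \<le> 1 / (pi / (2 * T) * real (Suc n))\<^sup>2"
      using assms(1) by (intro divide_left_mono) (auto simp: w_def freq_pos less_imp_neq[THEN not_sym])
    also have "\<dots> = (2 * T / pi)\<^sup>2 * inverse (real (Suc n) ^ 2)"
      by (simp add: power_divide power_mult_distrib field_simps del: of_nat_Suc)
    finally have w2: "1 / w\<^sup>2 \<le> (2 * T / pi)\<^sup>2 * inverse (real (Suc n) ^ 2)" .
    have "\<bar>sin (eig_arg N n) ^ 2\<bar> \<le> 1" by (simp add: abs_square_le_1)
    moreover have "\<bar>node_wt N j * node_sin N n j\<bar> \<le> 1 * 1"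
      unfolding abs_mult by (intro mult_mono) (auto simp: node_wt_def node_sin_def)
    ultimately have s: "\<bar>s\<bar> \<le> 1 * 1" unfolding s_def abs_mult[of "_ ^ 2"]
      by (intro mult_mono) auto
    have "\<bar>sine_fourier_coeff T (hat T N j) n\<bar> = 2 / T * (4 / (T / real N) * (1 / w\<^sup>2 * \<bar>s\<bar>))"
      using assms w unfolding sine_fourier_coeff_hat[OF assms] s_def w_def[symmetric]
      by (simp add: abs_mult)
    also have "\<dots> \<le> 2 / T * (4 / (T / real N) * ((2 * T / pi)\<^sup>2 * inverse (real (Suc n) ^ 2) * 1))"
      using assms(1) s w2 by (intro mult_left_mono mult_mono) auto
    finally show "norm \<bar>sine_fourier_coeff T (hat T N j) n\<bar> \<le> C * inverse (real (Suc n) ^ 2)"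
      by (simp add: C_def mult_ac)
  qed
qed

lemma LINT_const: "T \<ge> 0 \<Longrightarrow> (LINT t:{0<..<T}|lborel. c) = T * (c :: real)"
  using LINT_open_interval_eq[OF continuous_set_integrable, of T "\<lambda>_. c"] has_integral_const_real[of c 0 T]
  by simp

text \<open>With absolutely summable coefficients the cosine series converges uniformly, hence in \<open>L\<^sup>2\<close>.  This
produces a limit without any appeal to the completeness of \<open>L\<^sup>2\<close>.\<close>

lemma is_mod_Hilbert_suminf:
  assumes "T > 0" "summable (\<lambda>k. \<bar>sine_fourier_coeff T u k\<bar>)"
  shows "is_mod_Hilbert T u (\<lambda>t. \<Sum>k. sine_fourier_coeff T u k * cos (freq T k * t))"
proof -
  define c where "c = sine_fourier_coeff T u"
  define g where "g k t = c k * cos (freq T k * t)" for k t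
  define w where "w t = (\<Sum>k. g k t)" for t
  \<comment> \<open>The tails of the coefficient series bound the error of the partial sums, uniformly in \<open>t\<close>.\<close>
  define r where "r n = (\<Sum>k. \<bar>c k\<bar>) - (\<Sum>k<n. \<bar>c k\<bar>)" for n
  have sc: "summable (\<lambda>k. \<bar>c k\<bar>)" using assms by (simp add: c_def)
  have gc: "\<bar>g k t\<bar> \<le> \<bar>c k\<bar>" for k t
    unfolding g_def abs_mult using abs_cos_le_one[of "freq T k * t"]
    by (simp add: mult_left_le)
  have sg': "summable (\<lambda>k. \<bar>g k t\<bar>)" for t
    by (rule summable_comparison_test[OF _ sc]) (use gc in auto)
  then have sg: "summable (\<lambda>k. g k t)" for t by (rule summable_rabs_cancel)
  have meas [measurable]: "w \<in> borel_measurable borel" "g k \<in> borel_measurable borel" for k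
    unfolding w_def g_def by measurable
  have tail: "\<bar>w t - (\<Sum>k<n. g k t)\<bar> \<le> r n" for n t
  proof -
    have "w t - (\<Sum>k<n. g k t) = (\<Sum>k. g (k + n) t)"
      using suminf_split_initial_segment[OF sg, of t n] by (simp add: w_def)
    also have "\<bar>\<dots>\<bar> \<le> (\<Sum>k. \<bar>g (k + n) t\<bar>)"
      by (rule summable_rabs) (use summable_ignore_initial_segment[OF sg'] in simp)
    also have "\<dots> \<le> (\<Sum>k. \<bar>c (k + n)\<bar>)"
      by (rule suminf_le) (use gc summable_ignore_initial_segment[OF sg'] summable_ignore_initial_segment[OF sc] in auto)
    also have "\<dots> = r n"
      using suminf_split_initial_segment[OF sc, of n] by (simp add: r_def)
    finally show ?thesis .
  qed
  have tail2: "(w t - (\<Sum>k<n. g k t))\<^sup>2 \<le> (r n)\<^sup>2" for n t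
    using order_trans[OF tail abs_ge_self, of t n] by (simp only: abs_le_square_iff)
  have r0: "r \<longlonglongrightarrow> 0"
    using tendsto_diff[OF tendsto_const[of "\<Sum>k. \<bar>c k\<bar>"] summable_LIMSEQ[OF sc]] unfolding r_def by simp
  have sq: "set_integrable lborel {0<..<T} (\<lambda>t. (w t - (\<Sum>k<n. g k t))\<^sup>2)" for n
    by (rule bounded_set_integrable[where B = "(r n)\<^sup>2"], measurable) (use tail2 in simp)
  have "w \<in> L2 T"
    using sq[of 0] unfolding L2_def set_borel_measurable_def by simp
  moreover have "(\<lambda>n. LINT t:{0<..<T}|lborel. (w t - (\<Sum>k<n. g k t))\<^sup>2) \<longlonglongrightarrow> 0"
  proof (rule tendsto_sandwich)
    show "\<forall>\<^sub>F n in sequentially. 0 \<le> (LINT t:{0<..<T}|lborel. (w t - (\<Sum>k<n. g k t))\<^sup>2)"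
      by (simp add: set_lebesgue_integral_def integral_nonneg_AE)
    show "\<forall>\<^sub>F n in sequentially. (LINT t:{0<..<T}|lborel. (w t - (\<Sum>k<n. g k t))\<^sup>2) \<le> T * (r n)\<^sup>2"
    proof (intro always_eventually allI)
      fix n
      have "(LINT t:{0<..<T}|lborel. (w t - (\<Sum>k<n. g k t))\<^sup>2) \<le> (LINT t:{0<..<T}|lborel. (r n)\<^sup>2)"
      proof (rule set_integral_mono[OF sq])
        show "set_integrable lborel {0<..<T} (\<lambda>_. (r n)\<^sup>2)" by (intro continuous_set_integrable) simp
        show "(w t - (\<Sum>k<n. g k t))\<^sup>2 \<le> (r n)\<^sup>2" for t
          by (rule tail2)
      qed
      then show "(LINT t:{0<..<T}|lborel. (w t - (\<Sum>k<n. g k t))\<^sup>2) \<le> T * (r n)\<^sup>2"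
        using assms(1) by (simp add: LINT_const)
    qed
    show "(\<lambda>n. T * (r n)\<^sup>2) \<longlonglongrightarrow> 0"
      using tendsto_mult_left[OF tendsto_power[OF r0, of 2], of T] by simp
  qed simp
  ultimately show ?thesis unfolding is_mod_Hilbert_def w_def g_def c_def by simp
qed

text \<open>A form of the Cauchy--Schwarz inequality, obtained from \<open>\<bar>d\<bar> \<le> \<delta> + d\<^sup>2 / \<delta>\<close>.  Choosing \<open>\<delta>\<close> slightly larger
than the \<open>L\<^sup>2\<close> norm of \<open>d\<close> keeps it positive and makes both terms tend to \<open>0\<close>.\<close>

lemma L2_limit_imp_weak_limit:
  fixes f :: "real \<Rightarrow> real" and d :: "nat \<Rightarrow> real \<Rightarrow> real"
  assumes T: "T > 0"
    and f [measurable]: "f \<in> borel_measurable borel" and fB: "\<And>t. \<bar>f t\<bar> \<le> B" and B: "B \<ge> 0"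
    and dm: "\<And>n. set_borel_measurable lborel {0<..<T} (d n)"
    and d2: "\<And>n. set_integrable lborel {0<..<T} (\<lambda>t. (d n t)\<^sup>2)"
    and lim: "(\<lambda>n. LINT t:{0<..<T}|lborel. (d n t)\<^sup>2) \<longlonglongrightarrow> 0"
  shows "(\<lambda>n. LINT t:{0<..<T}|lborel. f t * d n t) \<longlonglongrightarrow> 0"
proof -
  define E where "E n = (LINT t:{0<..<T}|lborel. (d n t)\<^sup>2)" for n
  define \<delta> where "\<delta> n = sqrt (E n) + 1 / real (Suc n)" for n
  have E0: "E n \<ge> 0" for n
    by (simp add: E_def set_lebesgue_integral_def integral_nonneg_AE)
  have \<delta>0: "\<delta> n > 0" for n using E0[of n] by (simp add: \<delta>_def add_nonneg_pos)
  have c1: "set_integrable lborel {0<..<T} (\<lambda>_. c :: real)" for c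
    by (intro continuous_set_integrable) simp
  have maj: "set_integrable lborel {0<..<T} (\<lambda>t. B * \<delta> n + B / \<delta> n * (d n t)\<^sup>2)" for n
    by (intro set_integral_add c1 set_integrable_mult_right d2)
  have pt: "\<bar>f t * d n t\<bar> \<le> B * \<delta> n + B / \<delta> n * (d n t)\<^sup>2" for n t
  proof -
    have "0 \<le> (\<bar>d n t\<bar> - \<delta> n)\<^sup>2" "0 \<le> \<bar>d n t\<bar> * \<delta> n" using \<delta>0[of n] by simp_all
    then have "\<bar>d n t\<bar> * \<delta> n \<le> \<delta> n * \<delta> n + (d n t)\<^sup>2"
      by (simp add: power2_diff power2_eq_square algebra_simps)
    then have "\<bar>d n t\<bar> \<le> (\<delta> n * \<delta> n + (d n t)\<^sup>2) / \<delta> n"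
      using \<delta>0[of n] by (simp add: pos_le_divide_eq)
    also have "\<dots> = \<delta> n + (d n t)\<^sup>2 / \<delta> n" using \<delta>0[of n] by (simp add: add_divide_distrib)
    finally have "\<bar>f t\<bar> * \<bar>d n t\<bar> \<le> B * (\<delta> n + (d n t)\<^sup>2 / \<delta> n)"
      using fB B by (intro mult_mono) auto
    then show ?thesis by (simp add: abs_mult algebra_simps)
  qed
  have fm: "set_borel_measurable lborel {0<..<T} (\<lambda>t. f t * d n t)" for n
  proof -
    have "(\<lambda>t. f t * (indicat_real {0<..<T} t *\<^sub>R d n t)) \<in> borel_measurable lborel"
      using dm[of n] unfolding set_borel_measurable_def by measurable
    then show ?thesis unfolding set_borel_measurable_def by (simp add: mult_ac)
  qed
  have fi: "set_integrable lborel {0<..<T} (\<lambda>t. f t * d n t)" for n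
  proof (rule set_integrable_bound[OF maj[of n] fm], intro AE_I2 impI)
    show "norm (f t * d n t) \<le> norm (B * \<delta> n + B / \<delta> n * (d n t)\<^sup>2)" for t
      unfolding real_norm_def by (rule order_trans[OF pt abs_ge_self])
  qed
  have bound: "\<bar>LINT t:{0<..<T}|lborel. f t * d n t\<bar> \<le> B * T * \<delta> n + B * sqrt (E n)" for n
  proof -
    have "\<bar>LINT t:{0<..<T}|lborel. f t * d n t\<bar> \<le> (LINT t:{0<..<T}|lborel. \<bar>f t * d n t\<bar>)"
      using set_integral_norm_bound[OF fi] by simp
    also have "\<dots> \<le> (LINT t:{0<..<T}|lborel. B * \<delta> n + B / \<delta> n * (d n t)\<^sup>2)"
      using pt by (intro set_integral_mono maj set_integrable_abs fi)
    also have "\<dots> = B * T * \<delta> n + B / \<delta> n * E n"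
      using T c1 d2 by (subst set_integral_add) (auto simp: LINT_const E_def)
    also have "B / \<delta> n * E n \<le> B * sqrt (E n)"
    proof -
      have "E n = sqrt (E n) * sqrt (E n)" using E0 by simp
      also have "\<dots> \<le> \<delta> n * sqrt (E n)" using E0 by (intro mult_right_mono) (auto simp: \<delta>_def)
      finally have "E n / \<delta> n \<le> sqrt (E n)" using \<delta>0[of n] by (simp add: pos_divide_le_eq mult.commute)
      then show ?thesis using mult_left_mono[OF _ B] by fastforce
    qed
    finally show ?thesis by simp
  qed
  have sE: "(\<lambda>n. sqrt (E n)) \<longlonglongrightarrow> 0" using tendsto_real_sqrt[OF lim] by (simp add: E_def)
  have "\<delta> \<longlonglongrightarrow> 0" unfolding \<delta>_def
    using tendsto_add[OF sE LIMSEQ_Suc[OF lim_1_over_n]] by simp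
  then have "(\<lambda>n. B * T * \<delta> n + B * sqrt (E n)) \<longlonglongrightarrow> B * T * 0 + B * 0"
    by (intro tendsto_intros sE)
  then have "(\<lambda>n. B * T * \<delta> n + B * sqrt (E n)) \<longlonglongrightarrow> 0" by simp
  then show ?thesis by (rule Lim_null_comparison[rotated]) (use bound in auto)
qed

text \<open>The transform is some \<open>L\<^sup>2\<close> limit chosen by \<open>SOME\<close>.  The argument uses only that it is such a limit,
so that inner products with it can be evaluated term by term whatever representative was chosen.\<close>

lemma L2_inner_mod_Hilbert_sums:
  assumes T: "T > 0" and u: "summable (\<lambda>k. \<bar>sine_fourier_coeff T u k\<bar>)"
    and f [measurable]: "f \<in> borel_measurable borel" and fB: "\<And>t. \<bar>f t\<bar> \<le> B"
  shows "(\<lambda>k. sine_fourier_coeff T u k * L2_inner T f (\<lambda>t. cos (freq T k * t)))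
           sums L2_inner T f (mod_Hilbert T u)"
proof -
  define c where "c = sine_fourier_coeff T u"
  define w where "w = mod_Hilbert T u"
  define s where "s n t = (\<Sum>k<n. c k * cos (freq T k * t))" for n t
  have B: "B \<ge> 0" using fB[of 0] by simp
  have "is_mod_Hilbert T u w" unfolding w_def mod_Hilbert_def
    by (rule someI[of "is_mod_Hilbert T u"], rule is_mod_Hilbert_suminf[OF T u])
  then have w: "w \<in> L2 T" and lim: "(\<lambda>n. LINT t:{0<..<T}|lborel. (w t - s n t)\<^sup>2) \<longlonglongrightarrow> 0"
    unfolding is_mod_Hilbert_def s_def c_def by simp_all
  have wm: "set_borel_measurable lborel {0<..<T} w" and w2: "set_integrable lborel {0<..<T} (\<lambda>t. (w t)\<^sup>2)"
    using w by (simp_all add: L2_def)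
  have sm [measurable]: "s n \<in> borel_measurable borel" for n unfolding s_def by measurable
  have sc: "continuous_on A (s n)" for A n unfolding s_def by (intro continuous_intros)
  have dm: "set_borel_measurable lborel {0<..<T} (\<lambda>t. w t - s n t)" for n
  proof -
    have "(\<lambda>t. indicat_real {0<..<T} t *\<^sub>R w t - indicat_real {0<..<T} t *\<^sub>R s n t) \<in> borel_measurable lborel"
      using wm unfolding set_borel_measurable_def by measurable
    then show ?thesis unfolding set_borel_measurable_def by (simp add: right_diff_distrib)
  qed
  have d2: "set_integrable lborel {0<..<T} (\<lambda>t. (w t - s n t)\<^sup>2)" for n
  proof (rule set_integrable_bound)
    show "set_integrable lborel {0<..<T} (\<lambda>t. 2 * (w t)\<^sup>2 + 2 * (s n t)\<^sup>2)"
      by (intro set_integral_add set_integrable_mult_right w2 continuous_set_integrable continuous_intros sc)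
    have "(\<lambda>t. (indicat_real {0<..<T} t *\<^sub>R (w t - s n t))\<^sup>2) \<in> borel_measurable lborel"
      using dm[of n] unfolding set_borel_measurable_def by measurable
    moreover have "(indicat_real {0<..<T} t *\<^sub>R (w t - s n t))\<^sup>2 = indicat_real {0<..<T} t *\<^sub>R (w t - s n t)\<^sup>2" for t
      by (simp add: indicator_def)
    ultimately show "set_borel_measurable lborel {0<..<T} (\<lambda>t. (w t - s n t)\<^sup>2)"
      unfolding set_borel_measurable_def by simp
    have "(a - b)\<^sup>2 \<le> 2 * a\<^sup>2 + 2 * b\<^sup>2" for a b :: real
      using zero_le_power2[of "a + b"] by (simp add: power2_sum power2_diff)
    then show "AE t in lborel. t \<in> {0<..<T} \<longrightarrow> norm ((w t - s n t)\<^sup>2) \<le> norm (2 * (w t)\<^sup>2 + 2 * (s n t)\<^sup>2)"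
      by (auto simp: abs_of_nonneg)
  qed
  have w1: "set_integrable lborel {0<..<T} (\<lambda>t. f t * w t)"
  proof (rule set_integrable_bound)
    show "set_integrable lborel {0<..<T} (\<lambda>t. B * (1 + (w t)\<^sup>2))"
      by (intro set_integrable_mult_right set_integral_add w2 continuous_set_integrable) simp
    have "(\<lambda>t. f t * (indicat_real {0<..<T} t *\<^sub>R w t)) \<in> borel_measurable lborel"
      using wm unfolding set_borel_measurable_def by measurable
    then show "set_borel_measurable lborel {0<..<T} (\<lambda>t. f t * w t)"
      unfolding set_borel_measurable_def by (simp add: mult_ac)
    have "\<bar>a\<bar> \<le> 1 + a\<^sup>2" for a :: real
      using zero_le_power2[of "\<bar>a\<bar> - 1"] by (simp add: power2_diff)
    then have "\<bar>f t\<bar> * \<bar>w t\<bar> \<le> B * (1 + (w t)\<^sup>2)" for t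
      using fB B by (intro mult_mono) auto
    then show "AE t in lborel. t \<in> {0<..<T} \<longrightarrow> norm (f t * w t) \<le> norm (B * (1 + (w t)\<^sup>2))"
      using B by (auto simp: abs_mult)
  qed
  have fc: "set_integrable lborel {0<..<T} (\<lambda>t. f t * cos (freq T k * t))" for k
  proof (rule bounded_set_integrable)
    show "(\<lambda>t. f t * cos (freq T k * t)) \<in> borel_measurable borel" by measurable
    show "\<bar>f t * cos (freq T k * t)\<bar> \<le> B" for t
      using mult_mono[OF fB[of t] abs_cos_le_one[of "freq T k * t"] B] by (simp add: abs_mult)
  qed
  have "(LINT t:{0<..<T}|lborel. f t * (w t - s n t))
      = L2_inner T f w - (\<Sum>k<n. c k * L2_inner T f (\<lambda>t. cos (freq T k * t)))" for n
  proof -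
    have ic: "set_integrable lborel {0<..<T} (\<lambda>t. c k * (f t * cos (freq T k * t)))" for k
      by (intro set_integrable_mult_right fc)
    have eq: "f t * (w t - s n t) = f t * w t - (\<Sum>k<n. c k * (f t * cos (freq T k * t)))" for t
      by (simp add: s_def right_diff_distrib sum_distrib_left mult_ac)
    have "(LINT t:{0<..<T}|lborel. (\<Sum>k<n. c k * (f t * cos (freq T k * t))))
       = (\<Sum>k<n. c k * (LINT t:{0<..<T}|lborel. f t * cos (freq T k * t)))"
      using ic unfolding set_lebesgue_integral_def set_integrable_def
      by (simp add: sum_distrib_left mult.left_commute[of "indicator _ _"])
    moreover have "set_integrable lborel {0<..<T} (\<lambda>t. \<Sum>k<n. c k * (f t * cos (freq T k * t)))"
      using ic unfolding set_integrable_def scaleR_sum_right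
      by (intro Bochner_Integration.integrable_sum) blast
    then have "(LINT t:{0<..<T}|lborel. f t * (w t - s n t)) = (LINT t:{0<..<T}|lborel. f t * w t)
        - (LINT t:{0<..<T}|lborel. \<Sum>k<n. c k * (f t * cos (freq T k * t)))"
      unfolding eq by (rule set_integral_diff(2)[OF w1])
    ultimately show ?thesis unfolding L2_inner_def by simp
  qed
  with L2_limit_imp_weak_limit[OF T f fB B dm d2 lim]
  have "(\<lambda>n. L2_inner T f w - (\<Sum>k<n. c k * L2_inner T f (\<lambda>t. cos (freq T k * t)))) \<longlonglongrightarrow> 0"
    by (simp only:)
  from tendsto_diff[OF tendsto_const[of "L2_inner T f w"] this]
  show ?thesis unfolding sums_def c_def w_def by simp
qed

section \<open>The stiffness matrix\<close>

lemma stiffness_entry_sums: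
  assumes "T > 0" "N \<ge> 1" "i \<in> {1..N}" "j \<in> {1..N}"
  shows "(\<lambda>k. freq T k * (T / 2) * (sine_fourier_coeff T (hat T N j) k * sine_fourier_coeff T (hat T N i) k))
    sums L2_inner T (deriv (hat T N i)) (mod_Hilbert T (hat T N j))"
proof -
  obtain B where B: "\<And>t. \<bar>deriv (hat T N i) t\<bar> \<le> B"
    using deriv_hat_bounded[OF assms(1,2)] by blast
  have "(\<lambda>k. sine_fourier_coeff T (hat T N j) k * L2_inner T (deriv (hat T N i)) (\<lambda>t. cos (freq T k * t)))
    sums L2_inner T (deriv (hat T N i)) (mod_Hilbert T (hat T N j))"
    using B by (intro L2_inner_mod_Hilbert_sums assms sine_fourier_coeff_hat_summable deriv_hat_measurable)
  then show ?thesis unfolding deriv_hat_cos[OF assms(1-3)] by (simp add: mult_ac)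
qed

text \<open>Among any \<open>2 * N\<close> consecutive frequencies starting at a multiple of \<open>2 * N\<close>, exactly two alias
to the frequency \<open>l\<close> on the mesh, the second one with the opposite sign.\<close>

lemma node_sin_aliasing:
  assumes "l < N" "r < 2 * N"
  shows "(\<Sum>i = 1..N. node_wt N i * (node_sin N (2 * N * \<mu> + r) i * node_sin N l i))
    = (if r = l then real N / 2 else if r = 2 * N - 1 - l then - real N / 2 else 0)"
proof -
  have N: "N \<ge> 1" using assms by simp
  show ?thesis
  proof (cases "r < N")
    case True
    then show ?thesis using node_sin_orthogonal[OF True assms(1)] assms
      by (auto simp: node_sin_periodic[OF N])
  next
    case False
    define r' where "r' = 2 * N - 1 - r"
    have r': "r' < N" "r = 2 * N - 1 - r'" "r' < 2 * N" using False assms by (auto simp: r'_def)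
    have "(\<Sum>i = 1..N. node_wt N i * (node_sin N r i * node_sin N l i))
        = - (\<Sum>i = 1..N. node_wt N i * (node_sin N r' i * node_sin N l i))"
      unfolding r'(2) node_sin_reflect[OF r'(3)] by (simp add: sum_negf)
    moreover have "r' = l \<longleftrightarrow> r = 2 * N - 1 - l" "r \<noteq> l" using False assms by (auto simp: r'_def)
    ultimately show ?thesis
      using node_sin_orthogonal[OF r'(1) assms(1)] by (simp add: node_sin_periodic[OF N])
  qed
qed

lemma sin_eig_arg_periodic:
  assumes "N \<ge> 1"
  shows "(sin (eig_arg N (2 * N * \<mu> + r)))\<^sup>2 = (sin (eig_arg N r))\<^sup>2"
proof -
  have "eig_arg N (2 * N * \<mu> + r) = eig_arg N r + real \<mu> * pi"
    using assms by (simp add: eig_arg_def field_simps)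
  then show ?thesis by (cases "even \<mu>") (simp_all add: sin_add)
qed

lemma sin_eig_arg_reflect:
  assumes "r < 2 * N"
  shows "sin (eig_arg N (2 * N - 1 - r)) = sin (eig_arg N r)"
proof -
  have "eig_arg N (2 * N - 1 - r) = pi - eig_arg N r"
    using assms by (simp add: eig_arg_def of_nat_diff field_simps)
  then show ?thesis by simp
qed

lemma sin_eig_arg_pos:
  assumes "l < 2 * N"
  shows "sin (eig_arg N l) > 0"
proof (rule sin_gt_zero)
  show "0 < eig_arg N l" using assms by (simp add: eig_arg_def add_pos_nonneg)
  have "(real l + 1 / 2) / (2 * real N) < 1" using assms by simp
  moreover have "eig_arg N l = (real l + 1 / 2) / (2 * real N) * pi"
    by (simp add: eig_arg_def add_divide_distrib algebra_simps)
  ultimately show "eig_arg N l < pi" using mult_strict_right_mono[OF _ pi_gt_zero] by fastforce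
qed

text \<open>Multiplying the series of the matrix entries by the sampled sine \<open>l\<close> leaves, by orthogonality, two
frequencies in each block of \<open>2 * N\<close>.  Each hat coefficient contributes \<open>1 / freq\<^sup>2\<close> and the
derivative contributes \<open>freq\<close>, whence the cubes in \<open>eig_term\<close>; the two summands of \<open>eig_term\<close>
are the two aliases.  The opposite sign of the second alias enters twice and cancels.  The numerators \<open>sin\<^sup>4\<close> are the same for all aliases.\<close>

lemma stiffness_node_sin_sums:
  assumes "T > 0" "l < N" "j \<in> {1..N}"
  shows "(\<lambda>\<mu>. 128 * real N ^ 3 * sin (eig_arg N l) ^ 4 / (pi ^ 3 * (2 * real l + 1) ^ 4)
             * (node_wt N j * node_sin N l j) * eig_term N l \<mu>)
    sums (\<Sum>i = 1..N. L2_inner T (deriv (hat T N i)) (mod_Hilbert T (hat T N j)) * node_sin N l i)"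
proof -
  have N: "N \<ge> 1" using assms by simp
  define c where "c i = sine_fourier_coeff T (hat T N i)" for i
  define K where "K k = 2 / T * (4 * (sin (eig_arg N k))\<^sup>2 / (T / real N * (freq T k)\<^sup>2))" for k
  define G where "G k = (\<Sum>i = 1..N. node_wt N i * (node_sin N k i * node_sin N l i))" for k
  define F where "F k = freq T k * (T / 2) * (K k)\<^sup>2 * (node_wt N j * node_sin N k j) * G k" for k
  have c: "c i k = K k * (node_wt N i * node_sin N k i)" if "i \<in> {1..N}" for i k
    unfolding c_def K_def sine_fourier_coeff_hat[OF assms(1) N that] by (simp add: mult_ac)
  have "(\<lambda>k. \<Sum>i = 1..N. freq T k * (T / 2) * (c j k * c i k) * node_sin N l i)
    sums (\<Sum>i = 1..N. L2_inner T (deriv (hat T N i)) (mod_Hilbert T (hat T N j)) * node_sin N l i)"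
    unfolding c_def by (intro sums_sum sums_mult2 stiffness_entry_sums assms N)
  also have "(\<lambda>k. \<Sum>i = 1..N. freq T k * (T / 2) * (c j k * c i k) * node_sin N l i) = F"
  proof
    fix k
    have "(\<Sum>i = 1..N. freq T k * (T / 2) * (c j k * c i k) * node_sin N l i)
      = (\<Sum>i = 1..N. freq T k * (T / 2) * (K k)\<^sup>2 * (node_wt N j * node_sin N k j)
             * (node_wt N i * (node_sin N k i * node_sin N l i)))"
      using assms(3) by (intro sum.cong) (simp_all add: c power2_eq_square mult_ac)
    then show "(\<Sum>i = 1..N. freq T k * (T / 2) * (c j k * c i k) * node_sin N l i) = F k"
      by (simp only: F_def G_def sum_distrib_left)
  qed
  finally have "(\<lambda>\<mu>. sum F {\<mu> * (2 * N)..<\<mu> * (2 * N) + 2 * N})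
    sums (\<Sum>i = 1..N. L2_inner T (deriv (hat T N i)) (mod_Hilbert T (hat T N j)) * node_sin N l i)"
    by (rule sums_group) (use N in simp)
  also have "(\<lambda>\<mu>. sum F {\<mu> * (2 * N)..<\<mu> * (2 * N) + 2 * N}) =
     (\<lambda>\<mu>. 128 * real N ^ 3 * sin (eig_arg N l) ^ 4 / (pi ^ 3 * (2 * real l + 1) ^ 4)
             * (node_wt N j * node_sin N l j) * eig_term N l \<mu>)"
  proof
    fix \<mu>
    define l' where "l' = 2 * N - 1 - l"
    define C where "C = 128 * real N ^ 3 * sin (eig_arg N l) ^ 4 / pi ^ 3 * (node_wt N j * node_sin N l j)"
    have l': "l' < 2 * N" "l' \<noteq> l" "l < 2 * N" using assms by (auto simp: l'_def)
    have G: "G (2 * N * \<mu> + r) = (if r = l then real N / 2 else if r = l' then - real N / 2 else 0)"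
      if "r < 2 * N" for r
      unfolding G_def l'_def using node_sin_aliasing[OF assms(2) that] .
    have FC: "F k = C / (2 * real k + 1) ^ 3"
      if "sin (eig_arg N k) ^ 2 = sin (eig_arg N l) ^ 2" "node_sin N k j * G k = node_sin N l j * (real N / 2)" for k
    proof -
      define s where "s = sin (eig_arg N l)"
      define q where "q = 2 * real k + 1"
      have q: "q > 0" by (simp add: q_def add_nonneg_pos)
      have w: "freq T k = pi * q / (2 * T)" by (simp add: freq_def q_def field_simps)
      have "F k = freq T k * (T / 2) * (2 / T * (4 * s ^ 2 / (T / real N * (freq T k)\<^sup>2))) ^ 2
          * node_wt N j * (node_sin N k j * G k)"
        unfolding F_def K_def that(1) s_def by (simp add: mult_ac)
      also have "\<dots> = freq T k * (T / 2) * (2 / T * (4 * s ^ 2 / (T / real N * (freq T k)\<^sup>2))) ^ 2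
          * node_wt N j * (node_sin N l j * (real N / 2))"
        unfolding that(2) ..
      also have "\<dots> = C / q ^ 3"
        unfolding w C_def s_def[symmetric] using assms(1) q N
        by (simp add: field_simps eval_nat_numeral)
      finally show ?thesis by (simp add: q_def)
    qed
    have "sum F {\<mu> * (2 * N)..<\<mu> * (2 * N) + 2 * N} = (\<Sum>r<2 * N. F (2 * N * \<mu> + r))"
      using sum.shift_bounds_nat_ivl[of F 0 "\<mu> * (2 * N)" "2 * N"]
      by (simp add: atLeast0LessThan add.commute mult.commute mult.left_commute)
    also have "\<dots> = (\<Sum>r\<in>{l, l'}. F (2 * N * \<mu> + r))"
      by (rule sum.mono_neutral_right) (use l' in \<open>auto simp: F_def G\<close>)
    also have "\<dots> = F (2 * N * \<mu> + l) + F (2 * N * \<mu> + l')"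
      using l' by simp
    also have "F (2 * N * \<mu> + l) = C / (2 * real (2 * N * \<mu> + l) + 1) ^ 3"
      by (rule FC) (use l' in \<open>simp_all add: G sin_eig_arg_periodic[OF N] node_sin_periodic[OF N]\<close>)
    also have "F (2 * N * \<mu> + l') = C / (2 * real (2 * N * \<mu> + l') + 1) ^ 3"
    proof (rule FC)
      have "node_sin N l' j = - node_sin N l j" "sin (eig_arg N l') = sin (eig_arg N l)"
        unfolding l'_def using node_sin_reflect[OF l'(3)] sin_eig_arg_reflect[OF l'(3)] by simp_all
      then show "(sin (eig_arg N (2 * N * \<mu> + l')))\<^sup>2 = (sin (eig_arg N l))\<^sup>2"
        "node_sin N (2 * N * \<mu> + l') j * G (2 * N * \<mu> + l') = node_sin N l j * (real N / 2)"
        using l' by (simp_all add: G sin_eig_arg_periodic[OF N] node_sin_periodic[OF N])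
    qed
    also have "C / (2 * real (2 * N * \<mu> + l) + 1) ^ 3 + C / (2 * real (2 * N * \<mu> + l') + 1) ^ 3
       = C / (2 * real l + 1) ^ 4 * eig_term N l \<mu>"
    proof -
      have dist: "C / a ^ 3 + C / b ^ 3 = C / P * (P / a ^ 3 + P / b ^ 3)" if "P \<noteq> 0" for a b P :: real
        using that by (simp add: distrib_left)
      have eqs: "2 * real (2 * N * \<mu> + l) + 1 = 4 * real \<mu> * real N + 2 * real l + 1"
        "2 * real (2 * N * \<mu> + l') + 1 = 4 * real \<mu> * real N + 4 * real N - 1 - 2 * real l"
        using assms(2) by (simp_all add: l'_def of_nat_diff algebra_simps)
      show ?thesis unfolding eig_term_def eqs by (rule dist) (simp add: add_nonneg_eq_0_iff)
    qed
    also have "C / (2 * real l + 1) ^ 4 = 128 * real N ^ 3 * sin (eig_arg N l) ^ 4 / (pi ^ 3 * (2 * real l + 1) ^ 4)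
             * (node_wt N j * node_sin N l j)" by (simp add: C_def)
    finally show "sum F {\<mu> * (2 * N)..<\<mu> * (2 * N) + 2 * N} = 128 * real N ^ 3 * sin (eig_arg N l) ^ 4 / (pi ^ 3 * (2 * real l + 1) ^ 4)
             * (node_wt N j * node_sin N l j) * eig_term N l \<mu>" .
  qed
  finally show ?thesis .
qed

text \<open>The last row of the stiffness matrix provides convergence: there the sampled sine is
\<open>\<plusminus>1\<close>, so the factor in front of \<open>eig_term\<close> is not \<open>0\<close>.\<close>

lemma eig_term_summable:
  assumes "l < N"
  shows "summable (eig_term N l)"
proof -
  have N: "N \<ge> 1" using assms by simp
  define c where "c = 128 * real N ^ 3 * sin (eig_arg N l) ^ 4 / (pi ^ 3 * (2 * real l + 1) ^ 4)
             * (node_wt N N * node_sin N l N)"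
  have "summable (\<lambda>\<mu>. c * eig_term N l \<mu>)"
    using sums_summable[OF stiffness_node_sin_sums[of 1 l N N]] assms by (simp add: c_def)
  moreover have "c \<noteq> 0"
    using assms sin_eig_arg_pos[of l N]
    by (simp add: c_def node_wt_def node_sin_end[OF N] add_nonneg_eq_0_iff)
  ultimately show ?thesis by (simp add: summable_cmult_iff)
qed

lemma stiffness_node_sin:
  assumes "T > 0" "l < N" "j \<in> {1..N}"
  shows "(\<Sum>i = 1..N. L2_inner T (deriv (hat T N i)) (mod_Hilbert T (hat T N j)) * node_sin N l i)
    = eig_val T N l * (\<Sum>i = 1..N. L2_inner T (hat T N i) (hat T N j) * node_sin N l i)"
proof -
  have N: "N \<ge> 1" using assms by simp
  define s where "s = sin (eig_arg N l)"
  define d where "d = 2 + cos (2 * eig_arg N l)"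
  define E where "E = (\<Sum>\<mu>. eig_term N l \<mu>)"
  define y where "y = node_wt N j * node_sin N l j"
  define q where "q = 2 * real l + 1"
  have q: "q > 0" by (simp add: q_def add_nonneg_pos)
  have d: "d > 0" unfolding d_def using cos_ge_minus_one[of "2 * eig_arg N l"] by linarith
  have x: "eig_arg N l = pi * q / (4 * real N)" by (simp add: eig_arg_def q_def field_simps)
  have "(\<Sum>i = 1..N. L2_inner T (deriv (hat T N i)) (mod_Hilbert T (hat T N j)) * node_sin N l i)
     = 128 * real N ^ 3 * s ^ 4 / (pi ^ 3 * q ^ 4) * y * E"
    using sums_unique2[OF stiffness_node_sin_sums[OF assms] sums_mult[OF summable_sums[OF eig_term_summable[OF assms(2)]]]]
    by (simp add: s_def q_def y_def E_def)
  also have "\<dots> = 3 * pi / (2 * T) * (s ^ 4 / (pi * q / (4 * real N)) ^ 4) * (1 / d) * E * (T / real N / 3 * d * y)"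
    using N assms(1) q d by (simp add: field_simps eval_nat_numeral)
  finally show ?thesis
    unfolding mass_node_sin[OF assms(1) N assms(3)] eig_val_def s_def[symmetric] d_def[symmetric]
      E_def[symmetric] y_def[symmetric] x[symmetric] .
qed

section \<open>The eigenbasis and the eigenspaces\<close>

lemma eig_vec_carrier: "eig_vec N l \<in> carrier_vec N"
  by (simp add: eig_vec_def)

lemma eig_vec_index: "i < N \<Longrightarrow> eig_vec N l $ i = node_sin N l (Suc i)"
  by (simp add: eig_vec_def node_sin_def)

lemma node_sin_coeffs_unique:
  assumes "\<And>i. i \<in> {1..N} \<Longrightarrow> (\<Sum>l<N. b l * node_sin N l i) = 0" "k < N"
  shows "b k = 0"
proof -
  have "0 = (\<Sum>i = 1..N. node_wt N i * node_sin N k i * (\<Sum>l<N. b l * node_sin N l i))"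
    using assms(1) by simp
  also have "\<dots> = (\<Sum>i = 1..N. \<Sum>l<N. b l * (node_wt N i * (node_sin N k i * node_sin N l i)))"
    by (simp add: sum_distrib_left mult_ac)
  also have "\<dots> = (\<Sum>l<N. b l * (\<Sum>i = 1..N. node_wt N i * (node_sin N k i * node_sin N l i)))"
    by (subst sum.swap) (simp add: sum_distrib_left)
  also have "\<dots> = (\<Sum>l<N. if l = k then b k * (real N / 2) else 0)"
    using assms(2) by (intro sum.cong refl) (subst node_sin_orthogonal, auto)
  also have "\<dots> = b k * (real N / 2)" using assms(2) by simp
  finally show ?thesis using assms(2) by simp
qed

lemma eig_vec_inj: "inj_on (eig_vec N) {..<N}"
proof (rule inj_onI, rule ccontr)
  fix k l assume kl: "k \<in> {..<N}" "l \<in> {..<N}" "eig_vec N k = eig_vec N l" "k \<noteq> l"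
  have "node_sin N k i = node_sin N l i" if "i \<in> {1..N}" for i
  proof -
    have "i - 1 < N" "Suc (i - 1) = i" using that by auto
    then show ?thesis using eig_vec_index[of "i - 1" N k] eig_vec_index[of "i - 1" N l] kl(3) by simp
  qed
  then have "(\<Sum>i = 1..N. node_wt N i * (node_sin N k i * node_sin N l i))
     = (\<Sum>i = 1..N. node_wt N i * (node_sin N k i * node_sin N k i))"
    by (intro sum.cong) auto
  then show False using kl node_sin_orthogonal[of k N l] node_sin_orthogonal[of k N k] by simp
qed

context
  fixes N :: nat
begin

interpretation vec_space "TYPE(real)" N .

lemma eig_vec_lincomb_index:
  assumes "L \<subseteq> {..<N}" "i < N"
  shows "lincomb a (eig_vec N ` L) $ i = (\<Sum>l\<in>L. a (eig_vec N l) * node_sin N l (Suc i))"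
proof -
  have "lincomb a (eig_vec N ` L) $ i = (\<Sum>x\<in>eig_vec N ` L. a x * x $ i)"
    using assms eig_vec_carrier by (intro lincomb_index) auto
  also have "\<dots> = (\<Sum>l\<in>L. a (eig_vec N l) * eig_vec N l $ i)"
    by (subst sum.reindex) (use inj_on_subset[OF eig_vec_inj assms(1)] in auto)
  finally show ?thesis using assms by (simp add: eig_vec_index)
qed

lemma mem_span_eig_vec_iff:
  assumes "L \<subseteq> {..<N}"
  shows "v \<in> LinearCombinations.module.span class_ring (module_vec TYPE(real) N) (eig_vec N ` L) \<longleftrightarrow>
     v \<in> carrier_vec N \<and> (\<exists>b. \<forall>i<N. v $ i = (\<Sum>l\<in>L. b l * node_sin N l (Suc i)))"
    (is "?l \<longleftrightarrow> ?r")
proof -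
  have fin: "finite (eig_vec N ` L)" using finite_subset[OF assms] by simp
  have car: "eig_vec N ` L \<subseteq> carrier_vec N" using eig_vec_carrier by auto
  have span: "span (eig_vec N ` L) = {lincomb a (eig_vec N ` L) | a. a \<in> eig_vec N ` L \<rightarrow> UNIV}"
    using finite_span[OF fin car] by simp
  have lc: "lincomb a (eig_vec N ` L) \<in> carrier_vec N" for a
    using lincomb_closed[OF car, of a] by simp
  show ?thesis
  proof
    assume ?l
    then obtain a where "v = lincomb a (eig_vec N ` L)" unfolding span by blast
    then show ?r using lc eig_vec_lincomb_index[OF assms]
      by (intro conjI exI[of _ "\<lambda>l. a (eig_vec N l)"]) auto
  next
    assume ?r
    then obtain b where v: "v \<in> carrier_vec N" "\<And>i. i < N \<Longrightarrow> v $ i = (\<Sum>l\<in>L. b l * node_sin N l (Suc i))"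
      by blast
    define a where "a x = b (the_inv_into {..<N} (eig_vec N) x)" for x
    have "a (eig_vec N l) = b l" if "l \<in> L" for l
      using the_inv_into_f_f[OF eig_vec_inj, of l] that assms by (auto simp: a_def)
    then have "v = lincomb a (eig_vec N ` L)"
      using v lc[of a] by (intro eq_vecI) (auto simp: eig_vec_lincomb_index[OF assms])
    then show ?l unfolding span by blast
  qed
qed

lemma eig_vec_basis:
  "vectorspace.basis class_ring (module_vec TYPE(real) N) (eig_vec N ` {..<N})"
proof -
  have car: "eig_vec N ` {..<N} \<subseteq> carrier_vec N" using eig_vec_carrier by auto
  have "lin_indpt (eig_vec N ` {..<N})"
  proof (rule finite_lin_indpt2)
    fix a assume z: "lincomb a (eig_vec N ` {..<N}) = 0\<^sub>v N"
    have "(\<Sum>l<N. a (eig_vec N l) * node_sin N l i) = 0" if "i \<in> {1..N}" for i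
    proof -
      have "i - 1 < N" "Suc (i - 1) = i" using that by auto
      then show ?thesis using eig_vec_lincomb_index[OF order_refl, of "i - 1" a] z by simp
    qed
    from node_sin_coeffs_unique[OF this] show "\<forall>v\<in>eig_vec N ` {..<N}. a v = 0" by auto
  qed (use car in auto)
  moreover have "card (eig_vec N ` {..<N}) = N" using card_image[OF eig_vec_inj] by simp
  ultimately show ?thesis using car by (intro dim_li_is_basis) (auto simp: dim_is_n)
qed

lemma eig_vec_expansion:
  assumes "v \<in> carrier_vec N"
  obtains b where "\<And>i. i < N \<Longrightarrow> v $ i = (\<Sum>l<N. b l * node_sin N l (Suc i))"
proof -
  have "v \<in> span (eig_vec N ` {..<N})" using eig_vec_basis assms unfolding basis_def by auto
  then show ?thesis using that mem_span_eig_vec_iff[OF order_refl, of v] by blast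
qed

end

lemma mat_lincomb_node_sin:
  assumes "v \<in> carrier_vec N" "\<And>i. i < N \<Longrightarrow> v $ i = (\<Sum>l\<in>L. b l * node_sin N l (Suc i))" "j < N"
  shows "(mat N N (\<lambda>(j, i). X (Suc j) (Suc i)) *\<^sub>v v) $ j
    = (\<Sum>l\<in>L. b l * (\<Sum>i = 1..N. X (Suc j) i * node_sin N l i))"
proof -
  have "(mat N N (\<lambda>(j, i). X (Suc j) (Suc i)) *\<^sub>v v) $ j = (\<Sum>i<N. X (Suc j) (Suc i) * v $ i)"
    using assms(1,3) by (simp add: scalar_prod_def atLeast0LessThan)
  also have "\<dots> = (\<Sum>i<N. \<Sum>l\<in>L. b l * (X (Suc j) (Suc i) * node_sin N l (Suc i)))"
    using assms(2) by (intro sum.cong) (simp_all add: sum_distrib_left mult_ac)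
  also have "\<dots> = (\<Sum>l\<in>L. b l * (\<Sum>i<N. X (Suc j) (Suc i) * node_sin N l (Suc i)))"
    by (subst sum.swap) (simp add: sum_distrib_left)
  finally show ?thesis by (simp add: sum.atLeast1_atMost_eq)
qed

text \<open>In the basis of sampled sines, the pencil is diagonal up to the positive weights \<open>node_wt\<close>.\<close>

lemma A_M_lincomb_node_sin:
  assumes "T > 0" "L \<subseteq> {..<N}" "v \<in> carrier_vec N"
    "\<And>i. i < N \<Longrightarrow> v $ i = (\<Sum>l\<in>L. b l * node_sin N l (Suc i))" "j < N"
  shows "(A_mat T N *\<^sub>v v) $ j - c * (M_mat T N *\<^sub>v v) $ j
    = node_wt N (Suc j) * (\<Sum>l\<in>L. b l * (eig_val T N l - c) * (T / real N / 3 * (2 + cos (2 * eig_arg N l)))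
        * node_sin N l (Suc j))"
proof -
  have N: "N \<ge> 1" and J: "Suc j \<in> {1..N}" using assms(5) by auto
  have A: "(A_mat T N *\<^sub>v v) $ j = (\<Sum>l\<in>L. b l * (eig_val T N l *
      (\<Sum>i = 1..N. L2_inner T (hat T N i) (hat T N (Suc j)) * node_sin N l i)))"
    unfolding A_mat_def
    using mat_lincomb_node_sin[OF assms(3-5), of "\<lambda>j i. L2_inner T (deriv (hat T N i)) (mod_Hilbert T (hat T N j))"]
    by (simp only:) (intro sum.cong refl, use assms(2) stiffness_node_sin[OF assms(1) _ J] in auto)
  have M: "(M_mat T N *\<^sub>v v) $ j = (\<Sum>l\<in>L. b l * 
      (\<Sum>i = 1..N. L2_inner T (hat T N i) (hat T N (Suc j)) * node_sin N l i))"
    unfolding M_mat_def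
    using mat_lincomb_node_sin[OF assms(3-5), of "\<lambda>j i. L2_inner T (hat T N i) (hat T N j)"]
    by (simp only:)
  have factor: "b * (e * (K * (w * s))) - c * (b * (K * (w * s))) = w * (b * (e - c) * K * s)"
    for b e K w s :: real by (simp add: algebra_simps)
  show ?thesis unfolding A M mass_node_sin[OF assms(1) N J] sum_distrib_left sum_subtractf[symmetric]
    by (rule sum.cong[OF refl], rule factor)
qed

text \<open>By uniqueness of the coefficients the residual vanishes precisely when each coefficient of it does,
and the factors that come from the mass matrix are positive.\<close>

lemma gen_eigenpair_node_sin_iff:
  assumes "T > 0" "N \<ge> 1" "L \<subseteq> {..<N}" "v \<in> carrier_vec N"
    "\<And>i. i < N \<Longrightarrow> v $ i = (\<Sum>l\<in>L. b l * node_sin N l (Suc i))"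
  shows "gen_eigenpair (A_mat T N) (M_mat T N) c v \<longleftrightarrow> v \<noteq> 0\<^sub>v N \<and> (\<forall>l\<in>L. b l = 0 \<or> eig_val T N l = c)"
proof -
  define g where "g l = (if l \<in> L then b l * (eig_val T N l - c) * (T / real N / 3 * (2 + cos (2 * eig_arg N l))) else 0)" for l
  have dim: "dim_col (A_mat T N) = N" "dim_row (A_mat T N) = N" "dim_row (M_mat T N) = N"
    by (simp_all add: A_mat_def M_mat_def)
  have res: "(A_mat T N *\<^sub>v v) $ j - c * (M_mat T N *\<^sub>v v) $ j
    = node_wt N (Suc j) * (\<Sum>l<N. g l * node_sin N l (Suc j))" if "j < N" for j
  proof -
    have "(\<Sum>l\<in>L. b l * (eig_val T N l - c) * (T / real N / 3 * (2 + cos (2 * eig_arg N l)))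
        * node_sin N l (Suc j)) = (\<Sum>l<N. g l * node_sin N l (Suc j))"
      by (rule sum.mono_neutral_cong_left) (use assms(3) in \<open>auto simp: g_def\<close>)
    then show ?thesis using A_M_lincomb_node_sin[OF assms(1,3-5) that, of c] by simp
  qed
  have g0: "g l = 0 \<longleftrightarrow> b l = 0 \<or> eig_val T N l = c" if "l \<in> L" for l
  proof -
    have "2 + cos (2 * eig_arg N l) > 0" using cos_ge_minus_one[of "2 * eig_arg N l"] by linarith
    then show ?thesis using that assms(1,2) by (simp add: g_def)
  qed
  have "A_mat T N *\<^sub>v v = c \<cdot>\<^sub>v (M_mat T N *\<^sub>v v) \<longleftrightarrow>
      (\<forall>j<N. (A_mat T N *\<^sub>v v) $ j - c * (M_mat T N *\<^sub>v v) $ j = 0)"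
    by (auto simp: vec_eq_iff dim)
  also have "\<dots> \<longleftrightarrow> (\<forall>j<N. (\<Sum>l<N. g l * node_sin N l (Suc j)) = 0)"
    by (auto simp: res node_wt_def)
  also have "\<dots> \<longleftrightarrow> (\<forall>l<N. g l = 0)"
  proof
    assume z: "\<forall>j<N. (\<Sum>l<N. g l * node_sin N l (Suc j)) = 0"
    have "(\<Sum>l<N. g l * node_sin N l i) = 0" if "i \<in> {1..N}" for i
    proof -
      have "i - 1 < N" "Suc (i - 1) = i" using that by auto
      then show ?thesis using z[rule_format, of "i - 1"] by simp
    qed
    then show "\<forall>l<N. g l = 0" using node_sin_coeffs_unique by blast
  qed simp
  also have "\<dots> \<longleftrightarrow> (\<forall>l\<in>L. b l = 0 \<or> eig_val T N l = c)"
    using g0 assms(3) unfolding g_def by (metis lessThan_iff subsetD)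
  finally show ?thesis unfolding gen_eigenpair_def dim using assms(4) by simp
qed

theorem lemma4p2:
  fixes T :: real and N :: nat
  assumes "T > 0" and "N \<ge> 1"
  shows "(\<forall>l<N. summable (eig_term N l) \<and>
            gen_eigenpair (A_mat T N) (M_mat T N) (eig_val T N l) (eig_vec N l))
       \<and> inj_on (eig_vec N) {..<N}
       \<and> vectorspace.basis class_ring (module_vec TYPE(real) N) (eig_vec N ` {..<N})
       \<and> (\<forall>c v. gen_eigenpair (A_mat T N) (M_mat T N) c v \<longleftrightarrow>
            v \<noteq> 0\<^sub>v N \<and>
            v \<in> LinearCombinations.module.span class_ring (module_vec TYPE(real) N)
                  (eig_vec N ` {l. l < N \<and> eig_val T N l = c}))"
proof (intro conjI allI impI)
  fix l assume l: "l < N"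
  show "summable (eig_term N l)" using eig_term_summable[OF l] .
  have "eig_vec N l $ (N - 1) \<noteq> 0"
    using assms(2) by (simp add: eig_vec_index node_sin_end)
  then have "eig_vec N l \<noteq> 0\<^sub>v N" using assms(2) by auto
  then show "gen_eigenpair (A_mat T N) (M_mat T N) (eig_val T N l) (eig_vec N l)"
    using gen_eigenpair_node_sin_iff[OF assms, of "{l}" "eig_vec N l" "\<lambda>_. 1"] l
    by (simp add: eig_vec_carrier eig_vec_index)
next
  show "inj_on (eig_vec N) {..<N}" by (rule eig_vec_inj)
  show "vectorspace.basis class_ring (module_vec TYPE(real) N) (eig_vec N ` {..<N})"
    by (rule eig_vec_basis)
next
  fix c v
  let ?L = "{l. l < N \<and> eig_val T N l = c}"
  let ?span = "LinearCombinations.module.span class_ring (module_vec TYPE(real) N) (eig_vec N ` ?L)"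
  have L: "?L \<subseteq> {..<N}" by auto
  show "gen_eigenpair (A_mat T N) (M_mat T N) c v \<longleftrightarrow> v \<noteq> 0\<^sub>v N \<and> v \<in> ?span"
  proof
    assume e: "gen_eigenpair (A_mat T N) (M_mat T N) c v"
    then have v: "v \<in> carrier_vec N" by (simp add: gen_eigenpair_def A_mat_def)
    obtain b where b: "\<And>i. i < N \<Longrightarrow> v $ i = (\<Sum>l<N. b l * node_sin N l (Suc i))"
      using eig_vec_expansion[OF v] by blast
    have z: "v \<noteq> 0\<^sub>v N" "\<forall>l<N. b l = 0 \<or> eig_val T N l = c"
      using gen_eigenpair_node_sin_iff[OF assms order_refl v b] e by auto
    have "(\<Sum>l<N. b l * node_sin N l (Suc i)) = (\<Sum>l\<in>?L. b l * node_sin N l (Suc i))" for i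
      by (rule sum.mono_neutral_right) (use z(2) in auto)
    then show "v \<noteq> 0\<^sub>v N \<and> v \<in> ?span"
      using z(1) v b unfolding mem_span_eig_vec_iff[OF L] by auto
  next
    assume "v \<noteq> 0\<^sub>v N \<and> v \<in> ?span"
    then show "gen_eigenpair (A_mat T N) (M_mat T N) c v"
      unfolding mem_span_eig_vec_iff[OF L] using gen_eigenpair_node_sin_iff[OF assms L, of v] by auto
  qed
qed

end
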